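(* Let $G$ be a finite group, $\mathcal C\subset G$ a conjugacy class, $r\in\mathcal C$ with centraliser $C_G$, and $\pi$ an irreducible complex representation of $C_G$ on $V_\pi$. Let $W$ be a right $D^\vee(G)$-comodule whose pushout to an $H$-comodule contains $V_{r,\pi}$. Then there is an isomorphism of left $D^\vee(G)$-comodules $$E\cong\{(\mathcal F_{\mathcal C}^{-1}\otimes\mathrm{id}_W)(s)\ |\ s\in\ker(\mathrm{id}-P^{cov}_{r,\pi})\subseteq\mathbb C(\mathcal C)\otimes W\}\subseteq\mathbb CG\otimes W,$$ where the right hand side is a subcomodule of $\mathbb CG\otimes W$ with left coaction obtained by restriction from $\Delta_L(g\otimes w)=\sum_{f\in G}\delta_f\otimes f^{-1}gf\otimes f^{-1}gf\otimes f^{-1}\triangleright w$.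
   Context: $\mathbb C(G)$ denotes functions on $G$ with basis $\delta_g$, $\mathbb CG$ the group algebra, $e$ the identity. $D^\vee(G)$ is the Hopf algebra on $\mathbb C(G)\otimes\mathbb CG$ with tensor product algebra and counit and $\Delta(\delta_g\otimes h)=\sum_{f\in G}\delta_f\otimes f^{-1}ghg^{-1}f\otimes\delta_{f^{-1}g}\otimes h$, $S(\delta_g\otimes h)=\delta_{g^{-1}}\otimes gh^{-1}g^{-1}$. Right $D^\vee(G)$-comodules $W$ are $G$-crossed modules ($G$-graded, with left $G$-action, $|g\triangleright w|=g|w|g^{-1}$), with coaction $\Delta_Rw=\sum_{g\in G}g\triangleright w\otimes\delta_g\otimes|w|$. $D(G)$ is the algebra on $\mathbb C(G)\otimes\mathbb CG$ with product $(\delta_g\otimes h)(\delta_u\otimes v)=\delta_{g,huh^{-1}}\delta_g\otimes hv$; it acts on $W$ by $(\delta_g\otimes h)\triangleright w=\delta_{g,h|w|h^{-1}}\,h\triangleright w$. $H=\mathbb C(C_G)\otimes\mathbb CG$ is the quotient Hopf algebra of $D^\vee(G)$ by $p:\delta_g\otimes h\mapsto\delta_g\otimes h$ if $g\in C_G$, else $0$; pushout means composing a coaction with $p$. $V_{r,\pi}=V_\pi$ with right $H$-coaction $v\mapsto\sum_{g\in C_G}\pi(g)v\otimes\delta_g\otimes r$. $E=(D^\vee(G)\otimes V_{r,\pi})^H$ is the space of invariants of the tensor product $H$-coaction ($D^\vee(G)$ having coaction $(\mathrm{id}\otimes p)\Delta$), a left $D^\vee(G)$-comodule via the coproduct of $D^\vee(G)$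 on the first factor. $q:\mathcal C\to G$ is a fixed map with $q_crq_c^{-1}=c$ and $q_r=e$. $P_{r,\pi}=\delta_r\otimes P_\pi\in D(G)$, where $P_\pi=\frac{\dim V_\pi}{|C_G|}\sum_{n\in C_G}\mathrm{Tr}_\pi(n^{-1})\,n\in\mathbb CC_G$. On $\mathbb C(\mathcal C)\otimes W$, $P^{cov}_{r,\pi}(\delta_c\otimes w)=\delta_c\otimes(q_cP_{r,\pi}q_c^{-1})\triangleright w$. $\mathcal F_{\mathcal C}^{-1}:\mathbb C(\mathcal C)\to\mathbb CG$ is $f\mapsto\sum_{c\in\mathcal C}f(c)\,c^{-1}$.
   Formalization: "Contains V_{r,π}" is read as "contains V_{r,π} exactly once" (multiplicity one); for higher multiplicity the isomorphism fails, e.g. G trivial, W = ℂ², where E has dimension 1 and the right-hand side dimension 2. *)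

theory Defs
  imports Complex_Main "HOL-Library.Function_Algebras" "HOL-Algebra.Group_Action"
begin

section \<open>Tensor products with finite-dimensional coordinate spaces\<close>

text \<open>
  If \<open>A\<close> has finite basis \<open>B\<close>, then \<open>A \<otimes> M\<close> (equivalently \<open>M \<otimes> A\<close>) is represented by the
  functions \<open>t\<close> into \<open>M\<close> that vanish off \<open>B\<close>; such a \<open>t\<close> stands for the sum of
  \<open>b \<otimes> t b\<close> over \<open>b \<in> B\<close>.  Thus \<open>tens b m\<close> is \<open>b \<otimes> m\<close>, and \<open>A\<close> itself is the case
  \<open>M = complex\<close>.  Iterated tensor products are curried functions.
\<close>

definition tens :: "'a \<Rightarrow> 'm::zero \<Rightarrow> 'a \<Rightarrow> 'm" where
  "tens b m = (\<lambda>x. if x = b then m else 0)"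

abbreviation ket :: "'a \<Rightarrow> 'a \<Rightarrow> complex" where
  "ket b \<equiv> tens b 1"

definition tensor_space :: "'a set \<Rightarrow> ('a \<Rightarrow> 'm::zero) set" where
  "tensor_space B = {t. \<forall>x. x \<notin> B \<longrightarrow> t x = 0}"

definition fscale :: "(complex \<Rightarrow> 'm \<Rightarrow> 'm) \<Rightarrow> complex \<Rightarrow> ('a \<Rightarrow> 'm) \<Rightarrow> 'a \<Rightarrow> 'm" where
  "fscale s c t = (\<lambda>x. s c (t x))"

section \<open>Bialgebras with a basis, and their comodules\<close>

text \<open>
  Structure maps are given on basis elements; \<open>bcomult A x a b\<close> is the coefficient of
  \<open>a \<otimes> b\<close> in the coproduct of \<open>x\<close>.
\<close>

record 'a based_bialgebra =
  bbasis :: "'a set"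
  bmult :: "'a \<Rightarrow> 'a \<Rightarrow> 'a \<Rightarrow> complex"
  bunit :: "'a \<Rightarrow> complex"
  bcomult :: "'a \<Rightarrow> 'a \<Rightarrow> 'a \<Rightarrow> complex"
  bcounit :: "'a \<Rightarrow> complex"

definition linear_on ::
  "(complex \<Rightarrow> 'm \<Rightarrow> 'm) \<Rightarrow> 'm::ab_group_add set \<Rightarrow> (complex \<Rightarrow> 'n \<Rightarrow> 'n) \<Rightarrow> 'n::ab_group_add set
    \<Rightarrow> ('m \<Rightarrow> 'n) \<Rightarrow> bool" where
  "linear_on s M t N \<phi> \<longleftrightarrow>
     (\<forall>m\<in>M. \<phi> m \<in> N) \<and> (\<forall>m\<in>M. \<forall>m'\<in>M. \<phi> (m + m') = \<phi> m + \<phi> m') \<and>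
     (\<forall>c. \<forall>m\<in>M. \<phi> (s c m) = t c (\<phi> m))"

text \<open>
  Comodules live on a subspace \<open>M\<close> of an ambient vector space with scalar multiplication \<open>s\<close>.
  Left and right coactions are both stored as \<open>\<rho> :: 'm \<Rightarrow> 'a \<Rightarrow> 'm\<close>: for a right coaction
  \<open>\<rho> m\<close> stands for the sum of \<open>\<rho> m a \<otimes> a\<close>, for a left coaction for the sum of \<open>a \<otimes> \<rho> m a\<close>.
  They differ in the coassociativity axiom only.
\<close>

definition right_comodule ::
  "'a based_bialgebra \<Rightarrow> (complex \<Rightarrow> 'm \<Rightarrow> 'm) \<Rightarrow> 'm::ab_group_add set \<Rightarrow> ('m \<Rightarrow> 'a \<Rightarrow> 'm) \<Rightarrow> bool"
  where
  "right_comodule A s M \<rho> \<longleftrightarrow>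
     vector_space s \<and> module.subspace s M \<and>
     linear_on s M (fscale s) (tensor_space (bbasis A)) \<rho> \<and>
     (\<forall>m\<in>M. \<forall>a. \<rho> m a \<in> M) \<and>
     (\<forall>m\<in>M. \<forall>a\<in>bbasis A. \<forall>b\<in>bbasis A.
        \<rho> (\<rho> m b) a = (\<Sum>x\<in>bbasis A. s (bcomult A x a b) (\<rho> m x))) \<and>
     (\<forall>m\<in>M. (\<Sum>x\<in>bbasis A. s (bcounit A x) (\<rho> m x)) = m)"

definition left_comodule ::
  "'a based_bialgebra \<Rightarrow> (complex \<Rightarrow> 'm \<Rightarrow> 'm) \<Rightarrow> 'm::ab_group_add set \<Rightarrow> ('m \<Rightarrow> 'a \<Rightarrow> 'm) \<Rightarrow> bool"
  where
  "left_comodule A s M \<rho> \<longleftrightarrow>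
     vector_space s \<and> module.subspace s M \<and>
     linear_on s M (fscale s) (tensor_space (bbasis A)) \<rho> \<and>
     (\<forall>m\<in>M. \<forall>a. \<rho> m a \<in> M) \<and>
     (\<forall>m\<in>M. \<forall>a\<in>bbasis A. \<forall>b\<in>bbasis A.
        \<rho> (\<rho> m a) b = (\<Sum>x\<in>bbasis A. s (bcomult A x a b) (\<rho> m x))) \<and>
     (\<forall>m\<in>M. (\<Sum>x\<in>bbasis A. s (bcounit A x) (\<rho> m x)) = m)"

definition right_subcomodule ::
  "'a based_bialgebra \<Rightarrow> (complex \<Rightarrow> 'm \<Rightarrow> 'm) \<Rightarrow> 'm::ab_group_add set \<Rightarrow> ('m \<Rightarrow> 'a \<Rightarrow> 'm)
    \<Rightarrow> 'm set \<Rightarrow> bool" where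
  "right_subcomodule A s M \<rho> U \<longleftrightarrow> right_comodule A s M \<rho> \<and> U \<subseteq> M \<and>
     module.subspace s U \<and> (\<forall>u\<in>U. \<forall>a. \<rho> u a \<in> U)"

definition left_subcomodule ::
  "'a based_bialgebra \<Rightarrow> (complex \<Rightarrow> 'm \<Rightarrow> 'm) \<Rightarrow> 'm::ab_group_add set \<Rightarrow> ('m \<Rightarrow> 'a \<Rightarrow> 'm)
    \<Rightarrow> 'm set \<Rightarrow> bool" where
  "left_subcomodule A s M \<rho> U \<longleftrightarrow> left_comodule A s M \<rho> \<and> U \<subseteq> M \<and>
     module.subspace s U \<and> (\<forall>u\<in>U. \<forall>a. \<rho> u a \<in> U)"

definition intertwining_iso ::
  "(complex \<Rightarrow> 'm \<Rightarrow> 'm) \<Rightarrow> 'm::ab_group_add set \<Rightarrow> ('m \<Rightarrow> 'a \<Rightarrow> 'm)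
    \<Rightarrow> (complex \<Rightarrow> 'n \<Rightarrow> 'n) \<Rightarrow> 'n::ab_group_add set \<Rightarrow> ('n \<Rightarrow> 'a \<Rightarrow> 'n) \<Rightarrow> ('m \<Rightarrow> 'n) \<Rightarrow> bool" where
  "intertwining_iso s M \<rho> t N \<sigma> \<phi> \<longleftrightarrow>
     linear_on s M t N \<phi> \<and> bij_betw \<phi> M N \<and> (\<forall>m\<in>M. \<forall>a. \<sigma> (\<phi> m) a = \<phi> (\<rho> m a))"

definition right_comodules_isomorphic ::
  "'a based_bialgebra \<Rightarrow> (complex \<Rightarrow> 'm \<Rightarrow> 'm) \<Rightarrow> 'm::ab_group_add set \<Rightarrow> ('m \<Rightarrow> 'a \<Rightarrow> 'm)
    \<Rightarrow> (complex \<Rightarrow> 'n \<Rightarrow> 'n) \<Rightarrow> 'n::ab_group_add set \<Rightarrow> ('n \<Rightarrow> 'a \<Rightarrow> 'n) \<Rightarrow> bool" where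
  "right_comodules_isomorphic A s M \<rho> t N \<sigma> \<longleftrightarrow>
     right_comodule A s M \<rho> \<and> right_comodule A t N \<sigma> \<and> (\<exists>\<phi>. intertwining_iso s M \<rho> t N \<sigma> \<phi>)"

definition left_comodules_isomorphic ::
  "'a based_bialgebra \<Rightarrow> (complex \<Rightarrow> 'm \<Rightarrow> 'm) \<Rightarrow> 'm::ab_group_add set \<Rightarrow> ('m \<Rightarrow> 'a \<Rightarrow> 'm)
    \<Rightarrow> (complex \<Rightarrow> 'n \<Rightarrow> 'n) \<Rightarrow> 'n::ab_group_add set \<Rightarrow> ('n \<Rightarrow> 'a \<Rightarrow> 'n) \<Rightarrow> bool" where
  "left_comodules_isomorphic A s M \<rho> t N \<sigma> \<longleftrightarrow>
     left_comodule A s M \<rho> \<and> left_comodule A t N \<sigma> \<and> (\<exists>\<phi>. intertwining_iso s M \<rho> t N \<sigma> \<phi>)"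

text \<open>
  Composition of a right coaction \<open>\<rho>\<close> with the linear map \<open>p\<close> given on the basis of \<open>A\<close>.
\<close>

definition pushout ::
  "'a based_bialgebra \<Rightarrow> (complex \<Rightarrow> 'm \<Rightarrow> 'm) \<Rightarrow> ('a \<Rightarrow> 'b \<Rightarrow> complex) \<Rightarrow> ('m \<Rightarrow> 'a \<Rightarrow> 'm)
    \<Rightarrow> 'm::ab_group_add \<Rightarrow> 'b \<Rightarrow> 'm" where
  "pushout A s p \<rho> w = (\<lambda>b. \<Sum>x\<in>bbasis A. s (p x b) (\<rho> w x))"

text \<open>
  The right \<open>H\<close>-coaction on \<open>A \<otimes> V\<close> that is the tensor product of \<open>(id \<otimes> p)\<Delta>\<close> on \<open>A\<close> and
  \<open>\<rho>\<close> on \<open>V\<close>, namely \<open>x \<otimes> v \<mapsto> x\<^sub>1 \<otimes> v\<^sub>0 \<otimes> p(x\<^sub>2) v\<^sub>1\<close>.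
\<close>

definition tensor_coaction ::
  "'a based_bialgebra \<Rightarrow> 'b based_bialgebra \<Rightarrow> ('a \<Rightarrow> 'b \<Rightarrow> complex) \<Rightarrow> (complex \<Rightarrow> 'v \<Rightarrow> 'v)
    \<Rightarrow> ('v \<Rightarrow> 'b \<Rightarrow> 'v) \<Rightarrow> ('a \<Rightarrow> 'v::ab_group_add) \<Rightarrow> 'b \<Rightarrow> 'a \<Rightarrow> 'v" where
  "tensor_coaction A H p s \<rho> t = (\<lambda>b y.
     \<Sum>x\<in>bbasis A. \<Sum>b1\<in>bbasis H. \<Sum>b2\<in>bbasis H.
       s ((\<Sum>z\<in>bbasis A. bcomult A x y z * p z b1) * bmult H b1 b2 b) (\<rho> (t x) b2))"

definition coinvariants ::
  "'b based_bialgebra \<Rightarrow> (complex \<Rightarrow> 'm \<Rightarrow> 'm) \<Rightarrow> 'm::ab_group_add set \<Rightarrow> ('m \<Rightarrow> 'b \<Rightarrow> 'm) \<Rightarrow> 'm set"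
  where
  "coinvariants H s M \<rho> = {m \<in> M. \<forall>b\<in>bbasis H. \<rho> m b = s (bunit H b) m}"

text \<open>The left coaction \<open>\<Delta> \<otimes> id\<close> of \<open>A\<close> on \<open>A \<otimes> V\<close>.\<close>

definition coproduct_coaction ::
  "'a based_bialgebra \<Rightarrow> (complex \<Rightarrow> 'v \<Rightarrow> 'v) \<Rightarrow> ('a \<Rightarrow> 'v::ab_group_add) \<Rightarrow> 'a \<Rightarrow> 'a \<Rightarrow> 'v" where
  "coproduct_coaction A s t = (\<lambda>a y. \<Sum>x\<in>bbasis A. s (bcomult A x a y) (t x))"

section \<open>Groups, representations and characters\<close>

definition conj_action :: "('g, 'z) monoid_scheme \<Rightarrow> 'g \<Rightarrow> 'g \<Rightarrow> 'g" where
  "conj_action G = (\<lambda>g. \<lambda>h\<in>carrier G. g \<otimes>\<^bsub>G\<^esub> h \<otimes>\<^bsub>G\<^esub> inv\<^bsub>G\<^esub> g)"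

definition conjugacy_classes :: "('g, 'z) monoid_scheme \<Rightarrow> 'g set set" where
  "conjugacy_classes G = orbits G (carrier G) (conj_action G)"

definition centraliser :: "('g, 'z) monoid_scheme \<Rightarrow> 'g \<Rightarrow> 'g set" where
  "centraliser G r = stabilizer G (conj_action G) r"

definition group_representation ::
  "('g, 'z) monoid_scheme \<Rightarrow> (complex \<Rightarrow> 'v::ab_group_add \<Rightarrow> 'v) \<Rightarrow> ('g \<Rightarrow> 'v \<Rightarrow> 'v) \<Rightarrow> bool" where
  "group_representation K s \<pi> \<longleftrightarrow>
     (\<forall>g\<in>carrier K. Vector_Spaces.linear s s (\<pi> g)) \<and> \<pi> \<one>\<^bsub>K\<^esub> = id \<and>
     (\<forall>g\<in>carrier K. \<forall>h\<in>carrier K. \<pi> (g \<otimes>\<^bsub>K\<^esub> h) = \<pi> g \<circ> \<pi> h)"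

definition irreducible_representation ::
  "('g, 'z) monoid_scheme \<Rightarrow> (complex \<Rightarrow> 'v::ab_group_add \<Rightarrow> 'v) \<Rightarrow> ('g \<Rightarrow> 'v \<Rightarrow> 'v) \<Rightarrow> bool" where
  "irreducible_representation K s \<pi> \<longleftrightarrow>
     group_representation K s \<pi> \<and> (UNIV :: 'v set) \<noteq> {0} \<and>
     (\<forall>U. module.subspace s U \<and> (\<forall>g\<in>carrier K. \<pi> g ` U \<subseteq> U) \<longrightarrow> U = {0} \<or> U = UNIV)"

text \<open>Trace of an endomorphism, computed in the basis \<open>B\<close> (it does not depend on \<open>B\<close>).\<close>

definition trace_in ::
  "(complex \<Rightarrow> 'v::ab_group_add \<Rightarrow> 'v) \<Rightarrow> 'v set \<Rightarrow> ('v \<Rightarrow> 'v) \<Rightarrow> complex" where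
  "trace_in s B T = (\<Sum>b\<in>B. module.representation s B (T b) b)"

section \<open>The Hopf algebra $D^\vee(G)$, its quotient $H$, and their comodules\<close>

text \<open>
  The pair \<open>(g, h)\<close> is the basis element \<open>\<delta>\<^sub>g \<otimes> h\<close>.  For a subgroup \<open>K\<close>,
  \<open>dvee_over G K\<close> is the algebra of functions on \<open>K\<close> tensor the group algebra of \<open>G\<close>, with the
  coproduct of $D^\vee(G)$ restricted to \<open>K\<close>: for \<open>K = carrier G\<close> this is $D^\vee(G)$, and for
  \<open>K\<close> the centraliser of \<open>r\<close> it is the quotient bialgebra along \<open>quotient_map K\<close>.
\<close>

definition dvee_over :: "('g, 'z) monoid_scheme \<Rightarrow> 'g set \<Rightarrow> ('g \<times> 'g) based_bialgebra" where
  "dvee_over G K = \<lparr>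
     bbasis = K \<times> carrier G,
     bmult = (\<lambda>(g, h) (u, v). if g = u then ket (g, h \<otimes>\<^bsub>G\<^esub> v) else 0),
     bunit = (\<Sum>g\<in>K. ket (g, \<one>\<^bsub>G\<^esub>)),
     bcomult = (\<lambda>(g, h). \<Sum>f\<in>K.
       tens (f, inv\<^bsub>G\<^esub> f \<otimes>\<^bsub>G\<^esub> g \<otimes>\<^bsub>G\<^esub> h \<otimes>\<^bsub>G\<^esub> inv\<^bsub>G\<^esub> g \<otimes>\<^bsub>G\<^esub> f) (ket (inv\<^bsub>G\<^esub> f \<otimes>\<^bsub>G\<^esub> g, h))),
     bcounit = (\<lambda>(g, h). if g = \<one>\<^bsub>G\<^esub> then 1 else 0) \<rparr>"

definition Dvee :: "('g, 'z) monoid_scheme \<Rightarrow> ('g \<times> 'g) based_bialgebra" where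
  "Dvee G = dvee_over G (carrier G)"

definition Hquot :: "('g, 'z) monoid_scheme \<Rightarrow> 'g \<Rightarrow> ('g \<times> 'g) based_bialgebra" where
  "Hquot G r = dvee_over G (centraliser G r)"

definition quotient_map :: "'g set \<Rightarrow> 'g \<times> 'g \<Rightarrow> 'g \<times> 'g \<Rightarrow> complex" where
  "quotient_map K = (\<lambda>(g, h). if g \<in> K then ket (g, h) else 0)"

abbreviation Hproj :: "('g, 'z) monoid_scheme \<Rightarrow> 'g \<Rightarrow> 'g \<times> 'g \<Rightarrow> 'g \<times> 'g \<Rightarrow> complex" where
  "Hproj G r \<equiv> quotient_map (centraliser G r)"

definition V_coaction ::
  "('g, 'z) monoid_scheme \<Rightarrow> 'g \<Rightarrow> ('g \<Rightarrow> 'v \<Rightarrow> 'v) \<Rightarrow> 'v::ab_group_add \<Rightarrow> 'g \<times> 'g \<Rightarrow> 'v" where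
  "V_coaction G r \<pi> v = (\<Sum>g\<in>centraliser G r. tens (g, r) (\<pi> g v))"

text \<open>
  The crossed module underlying a right $D^\vee(G)$-comodule with coaction \<open>\<rho>\<close>: \<open>cm_part\<close> is the
  projection to the component of degree \<open>h\<close>, and \<open>cm_act\<close> is the action of \<open>G\<close>.  Lemma \<open>right_comodule_Dvee\<close>
  recovers \<open>\<Delta>\<^sub>R w = \<Sum>g. g \<triangleright> w \<otimes> \<delta>\<^sub>g \<otimes> |w|\<close>, extended linearly to non-homogeneous \<open>w\<close>.
\<close>

definition cm_part :: "('g, 'z) monoid_scheme \<Rightarrow> ('w \<Rightarrow> 'g \<times> 'g \<Rightarrow> 'w) \<Rightarrow> 'g \<Rightarrow> 'w \<Rightarrow> 'w" where
  "cm_part G \<rho> h w = \<rho> w (\<one>\<^bsub>G\<^esub>, h)"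

definition cm_act ::
  "('g, 'z) monoid_scheme \<Rightarrow> ('w \<Rightarrow> 'g \<times> 'g \<Rightarrow> 'w) \<Rightarrow> 'g \<Rightarrow> 'w::ab_group_add \<Rightarrow> 'w" where
  "cm_act G \<rho> g w = (\<Sum>h\<in>carrier G. \<rho> w (g, h))"

lemma sum_fun_apply: "(sum F A) x = (\<Sum>a\<in>A. F a x)" for F :: "'a \<Rightarrow> 'b \<Rightarrow> 'c::comm_monoid_add"
  by (induction A rule: infinite_finite_induct) simp_all

lemma right_comodule_Dvee:
  fixes G :: "('g, 'z) monoid_scheme"
  assumes G: "group G" "finite (carrier G)" and W: "right_comodule (Dvee G) s UNIV \<rho>"
  shows "\<rho> w = (\<Sum>g\<in>carrier G. \<Sum>h\<in>carrier G. tens (g, h) (cm_act G \<rho> g (cm_part G \<rho> h w)))"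
    and "(\<Sum>h\<in>carrier G. cm_part G \<rho> h w) = w"
    and "h \<in> carrier G \<Longrightarrow> k \<in> carrier G \<Longrightarrow>
      cm_part G \<rho> k (cm_part G \<rho> h w) = (if k = h then cm_part G \<rho> h w else 0)"
    and "cm_act G \<rho> \<one>\<^bsub>G\<^esub> w = w"
    and "g \<in> carrier G \<Longrightarrow> h \<in> carrier G \<Longrightarrow>
      cm_act G \<rho> g (cm_act G \<rho> h w) = cm_act G \<rho> (g \<otimes>\<^bsub>G\<^esub> h) w"
    and "g \<in> carrier G \<Longrightarrow> h \<in> carrier G \<Longrightarrow>
      cm_act G \<rho> g (cm_part G \<rho> h w) =
        cm_part G \<rho> (g \<otimes>\<^bsub>G\<^esub> h \<otimes>\<^bsub>G\<^esub> inv\<^bsub>G\<^esub> g) (cm_act G \<rho> g w)"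
proof -
  interpret group G by fact
  interpret vector_space s using W by (simp add: right_comodule_def)
  let ?S = "carrier G"
  have lin: "linear_on s UNIV (fscale s) (tensor_space (?S \<times> ?S)) \<rho>"
    using W by (simp add: right_comodule_def Dvee_def dvee_over_def)
  have off: "\<rho> v x = 0" if "x \<notin> ?S \<times> ?S" for v x
    using lin that unfolding linear_on_def tensor_space_def by blast
  have add: "\<rho> (a + b) x = \<rho> a x + \<rho> b x" for a b x
    using lin unfolding linear_on_def by simp
  have zero: "\<rho> 0 x = 0" for x using add[of 0 0 x] by simp
  have sum: "\<rho> (sum f A) x = (\<Sum>i\<in>A. \<rho> (f i) x)" for f :: "'g \<Rightarrow> _" and A x
    by (induction A rule: infinite_finite_induct) (simp_all add: zero add)
  have mulrho: "\<rho> (\<rho> v (u, h)) (f, k) = (if k = u \<otimes>\<^bsub>G\<^esub> h \<otimes>\<^bsub>G\<^esub> inv\<^bsub>G\<^esub> u then \<rho> v (f \<otimes>\<^bsub>G\<^esub> u, h) else 0)"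
    if S: "u \<in> ?S" "h \<in> ?S" "f \<in> ?S" "k \<in> ?S" for v u h f k
  proof -
    have coef: "bcomult (Dvee G) (x, y) (f, k) (u, h) =
        (if y = h \<and> x = f \<otimes>\<^bsub>G\<^esub> u \<and> k = u \<otimes>\<^bsub>G\<^esub> h \<otimes>\<^bsub>G\<^esub> inv\<^bsub>G\<^esub> u then 1 else 0)"
      if xy: "x \<in> ?S" "y \<in> ?S" for x y
    proof -
      have "bcomult (Dvee G) (x, y) (f, k) (u, h) =
        (\<Sum>f'\<in>?S. if f' = f then (if k = inv\<^bsub>G\<^esub> f \<otimes>\<^bsub>G\<^esub> x \<otimes>\<^bsub>G\<^esub> y \<otimes>\<^bsub>G\<^esub> inv\<^bsub>G\<^esub> x \<otimes>\<^bsub>G\<^esub> f \<and>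
             u = inv\<^bsub>G\<^esub> f \<otimes>\<^bsub>G\<^esub> x \<and> h = y then 1 else 0) else 0)"
        unfolding Dvee_def dvee_over_def
        by (simp only: based_bialgebra.simps case_prod_conv sum_fun_apply)
          (rule sum.cong, auto simp: tens_def)
      also have "\<dots> = (if k = inv\<^bsub>G\<^esub> f \<otimes>\<^bsub>G\<^esub> x \<otimes>\<^bsub>G\<^esub> y \<otimes>\<^bsub>G\<^esub> inv\<^bsub>G\<^esub> x \<otimes>\<^bsub>G\<^esub> f \<and>
             u = inv\<^bsub>G\<^esub> f \<otimes>\<^bsub>G\<^esub> x \<and> h = y then 1 else 0)"
        using G(2) S by (simp add: sum.delta)
      also have "\<dots> = (if y = h \<and> x = f \<otimes>\<^bsub>G\<^esub> u \<and> k = u \<otimes>\<^bsub>G\<^esub> h \<otimes>\<^bsub>G\<^esub> inv\<^bsub>G\<^esub> u then 1 else 0)"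
      proof -
        have "u = inv\<^bsub>G\<^esub> f \<otimes>\<^bsub>G\<^esub> x \<longleftrightarrow> x = f \<otimes>\<^bsub>G\<^esub> u"
          using S xy by (metis inv_closed inv_solve_left m_assoc l_inv l_one r_inv)
        moreover have "inv\<^bsub>G\<^esub> f \<otimes>\<^bsub>G\<^esub> (f \<otimes>\<^bsub>G\<^esub> u) \<otimes>\<^bsub>G\<^esub> y \<otimes>\<^bsub>G\<^esub> inv\<^bsub>G\<^esub> (f \<otimes>\<^bsub>G\<^esub> u) \<otimes>\<^bsub>G\<^esub> f
            = u \<otimes>\<^bsub>G\<^esub> y \<otimes>\<^bsub>G\<^esub> inv\<^bsub>G\<^esub> u"
          using S xy by (simp add: m_assoc inv_mult_group) (simp add: m_assoc[symmetric])
        ultimately show ?thesis by auto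
      qed
      finally show ?thesis .
    qed
    have "\<rho> (\<rho> v (u, h)) (f, k) =
        (\<Sum>x\<in>?S \<times> ?S. s (bcomult (Dvee G) x (f, k) (u, h)) (\<rho> v x))"
      using W S by (simp add: right_comodule_def Dvee_def dvee_over_def)
    also have "\<dots> = (\<Sum>x\<in>?S \<times> ?S. if x = (f \<otimes>\<^bsub>G\<^esub> u, h) then
        (if k = u \<otimes>\<^bsub>G\<^esub> h \<otimes>\<^bsub>G\<^esub> inv\<^bsub>G\<^esub> u then \<rho> v x else 0) else 0)"
    proof (intro sum.cong refl)
      fix x assume "x \<in> ?S \<times> ?S"
      then obtain a b where "x = (a, b)" "a \<in> ?S" "b \<in> ?S" by blast
      then show "s (bcomult (Dvee G) x (f, k) (u, h)) (\<rho> v x) = (if x = (f \<otimes>\<^bsub>G\<^esub> u, h) then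
          (if k = u \<otimes>\<^bsub>G\<^esub> h \<otimes>\<^bsub>G\<^esub> inv\<^bsub>G\<^esub> u then \<rho> v x else 0) else 0)"
        by (simp add: coef)
    qed
    finally show ?thesis using G(2) S by (simp add: sum.delta)
  qed
  show parts: "(\<Sum>h\<in>?S. cm_part G \<rho> h w) = w" for w
  proof -
    have "w = (\<Sum>x\<in>?S \<times> ?S. s (bcounit (Dvee G) x) (\<rho> w x))"
      using W by (simp add: right_comodule_def Dvee_def dvee_over_def)
    also have "\<dots> = (\<Sum>g\<in>?S. \<Sum>h\<in>?S. if g = \<one>\<^bsub>G\<^esub> then \<rho> w (g, h) else 0)"
      by (auto simp: sum.cartesian_product Dvee_def dvee_over_def intro!: sum.cong)
    also have "\<dots> = (\<Sum>h\<in>?S. cm_part G \<rho> h w)"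
      using G(2) by (subst sum.swap) (simp add: cm_part_def sum.delta)
    finally show ?thesis by simp
  qed
  show "cm_part G \<rho> k (cm_part G \<rho> h w) = (if k = h then cm_part G \<rho> h w else 0)"
    if "h \<in> ?S" "k \<in> ?S" using that by (simp add: cm_part_def mulrho)
  have act_part: "cm_act G \<rho> g (cm_part G \<rho> h w) = \<rho> w (g, h)" if "g \<in> ?S" "h \<in> ?S" for g h w
    using that G(2) by (simp add: cm_act_def cm_part_def mulrho sum.delta)
  show "\<rho> w = (\<Sum>g\<in>?S. \<Sum>h\<in>?S. tens (g, h) (cm_act G \<rho> g (cm_part G \<rho> h w)))"
  proof
    fix x
    have "(\<Sum>y\<in>?S \<times> ?S. if x = y then \<rho> w y else 0) = \<rho> w x"
      using G(2) off by (simp add: sum.delta)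
    then show "\<rho> w x = (\<Sum>g\<in>?S. \<Sum>h\<in>?S. tens (g, h) (cm_act G \<rho> g (cm_part G \<rho> h w))) x"
      by (simp add: sum_fun_apply tens_def act_part sum.cartesian_product
          case_prod_unfold cong: sum.cong if_cong)
  qed
  show "cm_act G \<rho> \<one>\<^bsub>G\<^esub> w = w"
    using parts by (simp add: cm_act_def cm_part_def)
  show "cm_act G \<rho> g (cm_act G \<rho> h w) = cm_act G \<rho> (g \<otimes>\<^bsub>G\<^esub> h) w" if "g \<in> ?S" "h \<in> ?S"
    using that G(2)
    by (simp add: cm_act_def sum mulrho sum.delta sum.swap[of _ ?S ?S])
  show "cm_act G \<rho> g (cm_part G \<rho> h w) =
      cm_part G \<rho> (g \<otimes>\<^bsub>G\<^esub> h \<otimes>\<^bsub>G\<^esub> inv\<^bsub>G\<^esub> g) (cm_act G \<rho> g w)" if "g \<in> ?S" "h \<in> ?S"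
  proof -
    have eq: "g \<otimes>\<^bsub>G\<^esub> h \<otimes>\<^bsub>G\<^esub> inv\<^bsub>G\<^esub> g = g \<otimes>\<^bsub>G\<^esub> k \<otimes>\<^bsub>G\<^esub> inv\<^bsub>G\<^esub> g \<longleftrightarrow> k = h" if "k \<in> ?S" for k
      using that \<open>g \<in> ?S\<close> \<open>h \<in> ?S\<close> by auto
    show ?thesis
      using that G(2) by (simp add: act_part) (simp add: cm_act_def cm_part_def sum mulrho eq sum.delta)
  qed
qed

section \<open>Both sides of the isomorphism\<close>

text \<open>\<open>E_space\<close> is \<open>(D\<^sup>\<or>(G) \<otimes> V)\<^sup>H\<close>, inside the functions on \<open>carrier G \<times> carrier G\<close>.\<close>

definition E_space ::
  "('g, 'z) monoid_scheme \<Rightarrow> 'g \<Rightarrow> (complex \<Rightarrow> 'v \<Rightarrow> 'v) \<Rightarrow> ('g \<Rightarrow> 'v \<Rightarrow> 'v)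
    \<Rightarrow> ('g \<times> 'g \<Rightarrow> 'v::ab_group_add) set" where
  "E_space G r s \<pi> =
     coinvariants (Hquot G r) (fscale s) (tensor_space (bbasis (Dvee G)))
       (tensor_coaction (Dvee G) (Hquot G r) (Hproj G r) s (V_coaction G r \<pi>))"

text \<open>
  The quantum double \<open>D(G)\<close>, with \<open>(g, h)\<close> again standing for \<open>\<delta>\<^sub>g \<otimes> h\<close>; a group element \<open>h\<close>
  is the element \<open>1 \<otimes> h\<close>.
\<close>

definition double_mult ::
  "('g, 'z) monoid_scheme \<Rightarrow> ('g \<times> 'g \<Rightarrow> complex) \<Rightarrow> ('g \<times> 'g \<Rightarrow> complex) \<Rightarrow> 'g \<times> 'g \<Rightarrow> complex"
  where
  "double_mult G x y = (\<lambda>z.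
     \<Sum>(g, h)\<in>carrier G \<times> carrier G. \<Sum>(u, v)\<in>carrier G \<times> carrier G.
       x (g, h) * y (u, v) *
       (if g = h \<otimes>\<^bsub>G\<^esub> u \<otimes>\<^bsub>G\<^esub> inv\<^bsub>G\<^esub> h then ket (g, h \<otimes>\<^bsub>G\<^esub> v) z else 0))"

definition double_of_group :: "('g, 'z) monoid_scheme \<Rightarrow> 'g \<Rightarrow> 'g \<times> 'g \<Rightarrow> complex" where
  "double_of_group G h = (\<Sum>g\<in>carrier G. ket (g, h))"

definition double_act ::
  "('g, 'z) monoid_scheme \<Rightarrow> (complex \<Rightarrow> 'w \<Rightarrow> 'w) \<Rightarrow> ('w \<Rightarrow> 'g \<times> 'g \<Rightarrow> 'w)
    \<Rightarrow> ('g \<times> 'g \<Rightarrow> complex) \<Rightarrow> 'w::ab_group_add \<Rightarrow> 'w" where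
  "double_act G s \<rho> x w =
     (\<Sum>(g, h)\<in>carrier G \<times> carrier G. s (x (g, h))
        (\<Sum>k\<in>carrier G. if g = h \<otimes>\<^bsub>G\<^esub> k \<otimes>\<^bsub>G\<^esub> inv\<^bsub>G\<^esub> h then cm_act G \<rho> h (cm_part G \<rho> k w) else 0))"

definition P_pi ::
  "('g, 'z) monoid_scheme \<Rightarrow> 'g \<Rightarrow> (complex \<Rightarrow> 'v::ab_group_add \<Rightarrow> 'v) \<Rightarrow> 'v set
    \<Rightarrow> ('g \<Rightarrow> 'v \<Rightarrow> 'v) \<Rightarrow> 'g \<Rightarrow> complex" where
  "P_pi G r s B \<pi> = (\<lambda>n. if n \<in> centraliser G r
     then of_nat (vector_space.dim s (UNIV :: 'v set)) / of_nat (card (centraliser G r))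
            * trace_in s B (\<pi> (inv\<^bsub>G\<^esub> n))
     else 0)"

definition P_r_pi ::
  "('g, 'z) monoid_scheme \<Rightarrow> 'g \<Rightarrow> (complex \<Rightarrow> 'v::ab_group_add \<Rightarrow> 'v) \<Rightarrow> 'v set
    \<Rightarrow> ('g \<Rightarrow> 'v \<Rightarrow> 'v) \<Rightarrow> 'g \<times> 'g \<Rightarrow> complex" where
  "P_r_pi G r s B \<pi> = (\<lambda>(g, n). ket r g * P_pi G r s B \<pi> n)"

text \<open>
  \<open>P_cov G C q P\<close> is \<open>\<delta>\<^sub>c \<otimes> w \<mapsto> \<delta>\<^sub>c \<otimes> (q\<^sub>c P q\<^sub>c\<^sup>-\<^sup>1) \<triangleright> w\<close> on the space of functions on \<open>C\<close> tensor \<open>W\<close>.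
\<close>

definition P_cov ::
  "('g, 'z) monoid_scheme \<Rightarrow> 'g set \<Rightarrow> ('g \<Rightarrow> 'g) \<Rightarrow> ('g \<times> 'g \<Rightarrow> complex)
    \<Rightarrow> (complex \<Rightarrow> 'w \<Rightarrow> 'w) \<Rightarrow> ('w \<Rightarrow> 'g \<times> 'g \<Rightarrow> 'w) \<Rightarrow> ('g \<Rightarrow> 'w::ab_group_add) \<Rightarrow> 'g \<Rightarrow> 'w" where
  "P_cov G C q P s \<rho> t = (\<Sum>c\<in>C. tens c
     (double_act G s \<rho>
        (double_mult G (double_mult G (double_of_group G (q c)) P)
                       (double_of_group G (inv\<^bsub>G\<^esub> (q c))))
        (t c)))"

definition ker_P_cov ::
  "('g, 'z) monoid_scheme \<Rightarrow> 'g set \<Rightarrow> ('g \<Rightarrow> 'g) \<Rightarrow> ('g \<times> 'g \<Rightarrow> complex)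
    \<Rightarrow> (complex \<Rightarrow> 'w \<Rightarrow> 'w) \<Rightarrow> ('w \<Rightarrow> 'g \<times> 'g \<Rightarrow> 'w) \<Rightarrow> ('g \<Rightarrow> 'w::ab_group_add) set" where
  "ker_P_cov G C q P s \<rho> = {t \<in> tensor_space C. t - P_cov G C q P s \<rho> t = 0}"

text \<open>The map \<open>\<delta>\<^sub>c \<otimes> w \<mapsto> c\<^sup>-\<^sup>1 \<otimes> w\<close>.\<close>

definition inv_Fourier ::
  "('g, 'z) monoid_scheme \<Rightarrow> 'g set \<Rightarrow> ('g \<Rightarrow> 'w::ab_group_add) \<Rightarrow> 'g \<Rightarrow> 'w" where
  "inv_Fourier G C t = (\<Sum>c\<in>C. tens (inv\<^bsub>G\<^esub> c) (t c))"

definition F_ker_space ::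
  "('g, 'z) monoid_scheme \<Rightarrow> 'g set \<Rightarrow> ('g \<Rightarrow> 'g) \<Rightarrow> ('g \<times> 'g \<Rightarrow> complex)
    \<Rightarrow> (complex \<Rightarrow> 'w \<Rightarrow> 'w) \<Rightarrow> ('w \<Rightarrow> 'g \<times> 'g \<Rightarrow> 'w) \<Rightarrow> ('g \<Rightarrow> 'w::ab_group_add) set" where
  "F_ker_space G C q P s \<rho> = inv_Fourier G C ` ker_P_cov G C q P s \<rho>"

definition Delta_L ::
  "('g, 'z) monoid_scheme \<Rightarrow> ('w \<Rightarrow> 'g \<times> 'g \<Rightarrow> 'w)
    \<Rightarrow> ('g \<Rightarrow> 'w::ab_group_add) \<Rightarrow> 'g \<times> 'g \<Rightarrow> 'g \<Rightarrow> 'w" where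
  "Delta_L G \<rho> t = (\<Sum>g\<in>carrier G. \<Sum>f\<in>carrier G.
     tens (f, inv\<^bsub>G\<^esub> f \<otimes>\<^bsub>G\<^esub> g \<otimes>\<^bsub>G\<^esub> f)
       (tens (inv\<^bsub>G\<^esub> f \<otimes>\<^bsub>G\<^esub> g \<otimes>\<^bsub>G\<^esub> f) (cm_act G \<rho> (inv\<^bsub>G\<^esub> f) (t g))))"

end

theory Submission
  imports Defs "HOL-Computational_Algebra.Fundamental_Theorem_Algebra"
begin

text \<open>
  Both comodules consist of sections over the conjugacy class.  Writing \<open>K = C\<^sub>G\<close>, an invariant in
  \<open>E\<close> is \<open>\<Sum>g. \<delta>\<^sub>g \<otimes> r\<^sup>-\<^sup>1 \<otimes> \<tau> g\<close> with \<open>\<pi> k (\<tau> (g k)) = \<tau> g\<close>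
  for \<open>k \<in> K\<close>.  Schur's lemma shows that \<open>P\<^bsub>r,\<pi>\<^esub>\<close> is the identity on the copy \<open>U\<close> of \<open>V\<close> in
  the degree \<open>r\<close> part of \<open>W\<close>, and its image is a sum of values of \<open>K\<close>-maps \<open>V \<rightarrow> W\<close>, which all land
  in \<open>U\<close> since \<open>U\<close> is the only copy.  So the right hand side consists of the \<open>t\<close> supported
  on the inverses of the class with \<open>t (g r\<^sup>-\<^sup>1 g\<^sup>-\<^sup>1) \<in> g \<triangleright> U\<close>.  For a \<open>K\<close>-isomorphism \<open>\<iota> : V \<rightarrow> U\<close> the map
  sending \<open>\<tau>\<close> to \<open>t (g r\<^sup>-\<^sup>1 g\<^sup>-\<^sup>1) = g \<triangleright> \<iota> (\<tau> g)\<close> is then the isomorphism sought.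
\<close>

section \<open>Coordinate tensor spaces and restriction to subcomodules\<close>

lemma tens_apply: "tens b m x = (if x = b then m else 0)"
  by (simp add: tens_def)

lemma fscale_apply: "fscale s c t x = s c (t x)"
  by (simp add: fscale_def)

lemma vector_space_fscale:
  assumes "vector_space s"
  shows "vector_space (fscale s)"
proof -
  interpret vector_space s by fact
  show ?thesis
    by unfold_locales (auto simp: fscale_def fun_eq_iff scale_right_distrib scale_left_distrib)
qed

lemma subspace_iff:
  assumes "vector_space s"
  shows "module.subspace s U \<longleftrightarrow>
    0 \<in> U \<and> (\<forall>x\<in>U. \<forall>y\<in>U. x + y \<in> U) \<and> (\<forall>c. \<forall>x\<in>U. s c x \<in> U)"
proof -
  interpret vector_space s by fact
  show ?thesis by (simp add: subspace_def)
qed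

lemma subspace_tensor_space:
  assumes "vector_space s"
  shows "module.subspace (fscale s) (tensor_space B)"
proof -
  interpret vector_space s by fact
  show ?thesis
    by (simp add: subspace_iff[OF vector_space_fscale[OF assms]] tensor_space_def fscale_def)
qed

lemma left_comodule_if_left_subcomodule:
  assumes "left_subcomodule A s M \<rho> U"
  shows "left_comodule A s U \<rho>"
  using assms by (auto simp: left_subcomodule_def left_comodule_def linear_on_def subset_iff)

lemma right_comodule_if_right_subcomodule:
  assumes "right_subcomodule A s M \<rho> U"
  shows "right_comodule A s U \<rho>"
  using assms by (auto simp: right_subcomodule_def right_comodule_def linear_on_def subset_iff)

section \<open>Schur's lemma and the character projection\<close>

text \<open>A minimal polynomial argument: take p of least degree among the nonzero polynomials with
  p(T) v = 0. A root z gives p = (X - z) p', and p'(T) v is nonzero by minimality, hence an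
  eigenvector for z.\<close>

lemma ex_eigenvector:
  fixes s :: "complex \<Rightarrow> 'v::ab_group_add \<Rightarrow> 'v"
  assumes "finite_dimensional_vector_space s B" and T: "Vector_Spaces.linear s s T"
    and ne: "(UNIV :: 'v set) \<noteq> {0}"
  shows "\<exists>z v. v \<noteq> 0 \<and> T v = s z v"
proof -
  interpret finite_dimensional_vector_space s B by fact
  interpret T: Vector_Spaces.linear s s T by fact
  obtain v :: 'v where v: "v \<noteq> 0" using ne by blast
  \<comment> \<open>\<open>ev p\<close> is p(T) v.\<close>
  define ev where "ev p = (\<Sum>i\<le>degree p. s (coeff p i) ((T ^^ i) v))" for p
  \<comment> \<open>Padding with zero coefficients up to a common bound allows polynomials of
    different degrees to be compared term by term.\<close>
  have ev_eq: "ev p = (\<Sum>i\<le>n. s (coeff p i) ((T ^^ i) v))" if "degree p \<le> n" for p n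
    unfolding ev_def
    by (rule sum.mono_neutral_left) (use that in \<open>auto simp: coeff_eq_0\<close>)
  have ev_diff: "ev (p - p') = ev p - ev p'" for p p'
  proof -
    let ?n = "max (degree p) (degree p')"
    show ?thesis
      using degree_diff_le_max[of p p']
      by (simp add: ev_eq[of _ ?n] scale_left_diff_distrib sum_subtractf)
  qed
  have ev_smult: "ev (smult c p) = s c (ev p)" for c p
    by (simp add: ev_eq[of _ "degree p"] scale_sum_right)
  have ev_pCons: "ev (pCons 0 p) = T (ev p)" for p
  proof -
    have "ev (pCons 0 p) = (\<Sum>i\<le>Suc (degree p). s (coeff (pCons 0 p) i) ((T ^^ i) v))"
      by (rule ev_eq) (rule degree_pCons_le)
    also have "\<dots> = T (ev p)"
      by (simp add: sum.atMost_Suc_shift ev_def T.sum T.scale del: sum.atMost_Suc)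
    finally show ?thesis .
  qed
  have "\<exists>p. p \<noteq> 0 \<and> ev p = 0"
  \<comment> \<open>The family v, T v, T^2 v, ... up to exponent \<open>card B\<close> has one
    member too many to be independent. Dependence is a property of sets, so a repetition T^i v = T^j
    v is treated separately; there X^i - X^j annihilates v.\<close>
  proof (cases "inj_on (\<lambda>i. (T ^^ i) v) {..card B}")
    case True
    have "dependent ((\<lambda>i. (T ^^ i) v) ` {..card B})"
      using True independent_card_le_dim[of "(\<lambda>i. (T ^^ i) v) ` {..card B}" UNIV]
      by (auto simp: card_image dim_UNIV)
    then obtain u w where u: "(\<Sum>x\<in>(\<lambda>i. (T ^^ i) v) ` {..card B}. s (u x) x) = 0"
      and w: "w \<in> (\<lambda>i. (T ^^ i) v) ` {..card B}" "u w \<noteq> 0"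
      using dependent_finite[of "(\<lambda>i. (T ^^ i) v) ` {..card B}"] by auto
    define p where "p = (\<Sum>i\<le>card B. monom (u ((T ^^ i) v)) i)"
    have coeff: "coeff p i = (if i \<le> card B then u ((T ^^ i) v) else 0)" for i
      by (simp add: p_def coeff_sum)
    have "degree p \<le> card B" by (rule degree_le) (simp add: coeff)
    then have "ev p = 0" using u by (simp add: ev_eq coeff sum.reindex[OF True])
    moreover have "p \<noteq> 0" using w coeff by (metis (no_types, lifting) atMost_iff coeff_0 image_iff)
    ultimately show ?thesis by blast
  next
    case False
    then obtain i j where ij: "i \<noteq> j" "(T ^^ i) v = (T ^^ j) v" by (auto simp: inj_on_def)
    have "ev (monom 1 n) = (T ^^ n) v" for n
      by (simp add: ev_def degree_monom_eq if_distrib[of "\<lambda>c. s c _"] cong: if_cong)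
    then have "ev (monom 1 i - monom 1 j) = 0" using ij by (simp add: ev_diff)
    moreover have "monom 1 i - monom 1 j \<noteq> (0 :: complex poly)" using ij by (simp add: monom_eq_iff')
    ultimately show ?thesis by blast
  qed
  then obtain p where p: "p \<noteq> 0" "ev p = 0"
    and least: "\<And>p'. p' \<noteq> 0 \<Longrightarrow> ev p' = 0 \<Longrightarrow> degree p \<le> degree p'"
    using ex_has_least_nat[of "\<lambda>p. p \<noteq> 0 \<and> ev p = 0" _ degree] by metis
  have "degree p \<noteq> 0"
  proof
    assume "degree p = 0"
    then obtain a where "p = [:a:]" by (rule degree_eq_zeroE)
    with p v show False by (simp add: ev_def)
  qed
  then obtain z where "poly p z = 0"
    using fundamental_theorem_of_algebra[of p] by (auto simp: constant_degree)
  then obtain p' where p': "p = [:- z, 1:] * p'" by (auto simp: poly_eq_0_iff_dvd)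
  have "p' \<noteq> 0" using p p' by auto
  then have "degree p = Suc (degree p')" unfolding p' by (subst degree_mult_eq) auto
  then have "ev p' \<noteq> 0" using least[of p'] \<open>p' \<noteq> 0\<close> by auto
  \<comment> \<open>\<open>pCons 0\<close> is multiplication by X, so \<open>ev p = 0\<close> says
    that T maps p'(T) v to z times itself.\<close>
  moreover have "p = pCons 0 p' - smult z p'" by (simp add: p')
  then have "T (ev p') = s z (ev p')" using p by (simp add: ev_diff ev_smult ev_pCons)
  ultimately show ?thesis by blast
qed

text \<open>An eigenspace of T is invariant because T commutes with the action. It is nonzero, so
  irreducibility makes it the whole space.\<close>

lemma schur:
  fixes s :: "complex \<Rightarrow> 'v::ab_group_add \<Rightarrow> 'v"
  assumes "finite_dimensional_vector_space s B" and irr: "irreducible_representation K s \<pi>"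
    and T: "Vector_Spaces.linear s s T"
    and comm: "\<And>k v. k \<in> carrier K \<Longrightarrow> T (\<pi> k v) = \<pi> k (T v)"
  shows "\<exists>z. T = s z"
proof -
  interpret finite_dimensional_vector_space s B by fact
  interpret T: Vector_Spaces.linear s s T by fact
  obtain z v where z: "v \<noteq> 0" "T v = s z v"
    using ex_eigenvector[OF assms(1) T] irr unfolding irreducible_representation_def by blast
  let ?U = "{v. T v = s z v}"
  have "subspace ?U"
    by (auto simp: subspace_def T.add T.scale scale_right_distrib mult.commute)
  moreover have "\<pi> k ` ?U \<subseteq> ?U" if k: "k \<in> carrier K" for k
  proof -
    interpret \<pi>k: Vector_Spaces.linear s s "\<pi> k"
      using irr k by (simp add: irreducible_representation_def group_representation_def)
    show ?thesis using comm[OF k] by (auto simp: \<pi>k.scale)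
  qed
  ultimately have "?U = {0} \<or> ?U = UNIV"
    using irr by (simp add: irreducible_representation_def)
  then show ?thesis using z by auto
qed

text \<open>
  Averaging the rank one map \<open>v \<mapsto> \<phi> v \<cdot> w\<close> over the group; the character
  projection is a sum of values of such intertwiners.
\<close>

definition rank_one_average ::
  "('g, 'z) monoid_scheme \<Rightarrow> (complex \<Rightarrow> 'w::ab_group_add \<Rightarrow> 'w) \<Rightarrow> ('g \<Rightarrow> 'v \<Rightarrow> 'v) \<Rightarrow> ('g \<Rightarrow> 'w \<Rightarrow> 'w)
    \<Rightarrow> ('v \<Rightarrow> complex) \<Rightarrow> 'w \<Rightarrow> 'v \<Rightarrow> 'w" where
  "rank_one_average K s \<pi> \<sigma> \<phi> w v = (\<Sum>n\<in>carrier K. s (\<phi> (\<pi> (inv\<^bsub>K\<^esub> n) v)) (\<sigma> n w))"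

lemma linear_rank_one_average:
  assumes K: "group K" and \<pi>: "group_representation K s \<pi>" and \<sigma>: "group_representation K t \<sigma>"
    and "vector_space s" and "vector_space t" and \<phi>: "Vector_Spaces.linear s (*) \<phi>"
  shows "Vector_Spaces.linear s t (rank_one_average K t \<pi> \<sigma> \<phi> w)"
proof -
  interpret group K by fact
  interpret V: vector_space s by fact
  interpret W: vector_space t by fact
  interpret \<phi>: Vector_Spaces.linear s "(*)" \<phi> by fact
  have lin: "Vector_Spaces.linear s s (\<pi> (inv\<^bsub>K\<^esub> n))" if "n \<in> carrier K" for n
    using \<pi> that by (simp add: group_representation_def)
  show ?thesis
  proof unfold_locales
    fix x y
    show "rank_one_average K t \<pi> \<sigma> \<phi> w (x + y) =
        rank_one_average K t \<pi> \<sigma> \<phi> w x + rank_one_average K t \<pi> \<sigma> \<phi> w y"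
      unfolding rank_one_average_def sum.distrib[symmetric]
    proof (rule sum.cong[OF refl])
      fix n assume "n \<in> carrier K"
      then interpret Vector_Spaces.linear s s "\<pi> (inv\<^bsub>K\<^esub> n)" by (rule lin)
      show "t (\<phi> (\<pi> (inv\<^bsub>K\<^esub> n) (x + y))) (\<sigma> n w) =
          t (\<phi> (\<pi> (inv\<^bsub>K\<^esub> n) x)) (\<sigma> n w) + t (\<phi> (\<pi> (inv\<^bsub>K\<^esub> n) y)) (\<sigma> n w)"
        by (simp add: add \<phi>.add W.scale_left_distrib)
    qed
  next
    fix c x
    show "rank_one_average K t \<pi> \<sigma> \<phi> w (s c x) = t c (rank_one_average K t \<pi> \<sigma> \<phi> w x)"
      unfolding rank_one_average_def W.scale_sum_right
    proof (rule sum.cong[OF refl])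
      fix n assume "n \<in> carrier K"
      then interpret Vector_Spaces.linear s s "\<pi> (inv\<^bsub>K\<^esub> n)" by (rule lin)
      show "t (\<phi> (\<pi> (inv\<^bsub>K\<^esub> n) (s c x))) (\<sigma> n w) = t c (t (\<phi> (\<pi> (inv\<^bsub>K\<^esub> n) x)) (\<sigma> n w))"
        by (simp add: scale \<phi>.scale)
    qed
  qed
qed

text \<open>Substituting n = k m in the sum moves k from the argument of \<open>\<phi>\<close> to an
  outer \<open>\<sigma> k\<close>.\<close>

lemma rank_one_average_equivariant:
  assumes K: "group K" and \<pi>: "group_representation K s \<pi>" and \<sigma>: "group_representation K t \<sigma>"
    and k: "k \<in> carrier K"
  shows "rank_one_average K t \<pi> \<sigma> \<phi> w (\<pi> k v) = \<sigma> k (rank_one_average K t \<pi> \<sigma> \<phi> w v)"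
proof -
  interpret group K by fact
  interpret \<sigma>k: Vector_Spaces.linear t t "\<sigma> k" using \<sigma> k by (simp add: group_representation_def)
  have "rank_one_average K t \<pi> \<sigma> \<phi> w (\<pi> k v) =
      (\<Sum>n\<in>carrier K. t (\<phi> (\<pi> (inv\<^bsub>K\<^esub> n) (\<pi> k v))) (\<sigma> n w))"
    by (simp add: rank_one_average_def)
  also have "\<dots> = (\<Sum>m\<in>carrier K. t (\<phi> (\<pi> (inv\<^bsub>K\<^esub> m) v)) (\<sigma> k (\<sigma> m w)))"
  proof (rule sum.reindex_bij_witness[where i = "\<lambda>m. k \<otimes>\<^bsub>K\<^esub> m" and j = "\<lambda>n. inv\<^bsub>K\<^esub> k \<otimes>\<^bsub>K\<^esub> n"])
    fix n assume n: "n \<in> carrier K"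
    have "\<pi> (inv\<^bsub>K\<^esub> (inv\<^bsub>K\<^esub> k \<otimes>\<^bsub>K\<^esub> n)) v = \<pi> (inv\<^bsub>K\<^esub> n) (\<pi> k v)"
      using \<pi> k n by (simp add: group_representation_def inv_mult_group)
    moreover have "\<sigma> n w = \<sigma> k (\<sigma> (inv\<^bsub>K\<^esub> k \<otimes>\<^bsub>K\<^esub> n) w)"
    proof -
      have "k \<otimes>\<^bsub>K\<^esub> (inv\<^bsub>K\<^esub> k \<otimes>\<^bsub>K\<^esub> n) = n" using k n by (simp add: m_assoc[symmetric])
      then show ?thesis
        using \<sigma> k n unfolding group_representation_def by (metis comp_apply inv_closed m_closed)
    qed
    ultimately show "t (\<phi> (\<pi> (inv\<^bsub>K\<^esub> (inv\<^bsub>K\<^esub> k \<otimes>\<^bsub>K\<^esub> n)) v)) (\<sigma> k (\<sigma> (inv\<^bsub>K\<^esub> k \<otimes>\<^bsub>K\<^esub> n) w)) =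
        t (\<phi> (\<pi> (inv\<^bsub>K\<^esub> n) (\<pi> k v))) (\<sigma> n w)" by simp
  qed (use k in \<open>simp_all add: m_assoc[symmetric]\<close>)
  also have "\<dots> = \<sigma> k (rank_one_average K t \<pi> \<sigma> \<phi> w v)"
    by (simp add: rank_one_average_def \<sigma>k.sum \<sigma>k.scale)
  finally show ?thesis .
qed

text \<open>Expand the trace into diagonal coordinates and exchange the sums: a basis vector b
  contributes the average built from its own coordinate functional, evaluated at b.\<close>

lemma sum_character_scale:
  assumes "vector_space t" and "finite B"
  shows "(\<Sum>n\<in>carrier K. t (trace_in s B (\<pi> (inv\<^bsub>K\<^esub> n))) (\<sigma> n w)) =
    (\<Sum>b\<in>B. rank_one_average K t \<pi> \<sigma> (\<lambda>v. module.representation s B v b) w b)"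
proof -
  interpret vector_space t by fact
  have "(\<Sum>n\<in>carrier K. t (trace_in s B (\<pi> (inv\<^bsub>K\<^esub> n))) (\<sigma> n w)) =
      (\<Sum>n\<in>carrier K. \<Sum>b\<in>B. t (module.representation s B (\<pi> (inv\<^bsub>K\<^esub> n) b) b) (\<sigma> n w))"
    by (simp only: trace_in_def scale_sum_left)
  also have "\<dots> = (\<Sum>b\<in>B. \<Sum>n\<in>carrier K. t (module.representation s B (\<pi> (inv\<^bsub>K\<^esub> n) b) b) (\<sigma> n w))"
    by (rule sum.swap)
  finally show ?thesis by (simp only: rank_one_average_def)
qed

lemma linear_coordinate:
  fixes s :: "complex \<Rightarrow> 'v::ab_group_add \<Rightarrow> 'v"
  assumes "finite_dimensional_vector_space s B"
  shows "Vector_Spaces.linear s (*) (\<lambda>v. module.representation s B v b)"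
proof -
  interpret finite_dimensional_vector_space s B by fact
  interpret C: vector_space "(*) :: complex \<Rightarrow> _" by unfold_locales (simp_all add: algebra_simps)
  show ?thesis
  proof unfold_locales
    show "representation B (x + y) b = representation B x b + representation B y b" for x y
      using span_Basis independent_Basis by (simp add: representation_add)
    show "representation B (s c x) b = c * representation B x b" for c x
      using span_Basis independent_Basis by (simp add: representation_scale)
  qed
qed

text \<open>By Schur's lemma the average is a scalar z. Its trace is \<open>card B\<close> times z,
  and it is also a sum over the group of traces of rank one maps, each equal to
  \<open>\<phi> w\<close>. This is Schur orthogonality with denominators cleared.\<close>

lemma rank_one_average_irreducible:
  fixes s :: "complex \<Rightarrow> 'v::ab_group_add \<Rightarrow> 'v"
  assumes K: "group K" and fin: "finite_dimensional_vector_space s B"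
    and irr: "irreducible_representation K s \<pi>" and \<phi>: "Vector_Spaces.linear s (*) \<phi>"
  shows "s (of_nat (card B)) (rank_one_average K s \<pi> \<pi> \<phi> w v) =
    s (of_nat (card (carrier K)) * \<phi> w) v"
proof -
  interpret group K by fact
  interpret finite_dimensional_vector_space s B by fact
  interpret \<phi>: Vector_Spaces.linear s "(*)" \<phi> by fact
  let ?R = "\<lambda>v. representation B v"
  let ?T = "rank_one_average K s \<pi> \<pi> \<phi> w"
  have \<pi>: "group_representation K s \<pi>" using irr by (simp add: irreducible_representation_def)
  have "\<exists>z. ?T = s z"
  proof (rule schur[OF fin irr])
    show "Vector_Spaces.linear s s ?T"
      by (rule linear_rank_one_average[OF K \<pi> \<pi> vector_space_axioms vector_space_axioms \<phi>])
    show "?T (\<pi> k v) = \<pi> k (?T v)" if "k \<in> carrier K" for k v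
      by (rule rank_one_average_equivariant[OF K \<pi> \<pi> that])
  qed
  then obtain z where z: "?T = s z" ..
  have Rsum: "(\<Sum>b\<in>B. s (?R x b) b) = x" for x
    using sum_representation_eq[OF independent_Basis _ finite_Basis order_refl] by (simp add: span_Basis)
  have "of_nat (card B) * z = (\<Sum>b\<in>B. ?R (?T b) b)"
    using independent_Basis by (simp add: z representation_scale span_Basis representation_basis)
  also have "\<dots> = (\<Sum>b\<in>B. \<Sum>n\<in>carrier K. \<phi> (\<pi> (inv\<^bsub>K\<^esub> n) b) * ?R (\<pi> n w) b)"
    using independent_Basis
    by (simp add: rank_one_average_def representation_sum representation_scale span_Basis)
  also have "\<dots> = (\<Sum>n\<in>carrier K. \<Sum>b\<in>B. \<phi> (\<pi> (inv\<^bsub>K\<^esub> n) b) * ?R (\<pi> n w) b)"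
    by (rule sum.swap)
  also have "\<dots> = (\<Sum>n\<in>carrier K. \<phi> w)"
  proof (rule sum.cong[OF refl])
    fix n assume n: "n \<in> carrier K"
    interpret \<pi>n: Vector_Spaces.linear s s "\<pi> (inv\<^bsub>K\<^esub> n)"
      using \<pi> n by (simp add: group_representation_def)
    \<comment> \<open>The trace of a rank one map v \<mapsto> f(v) y is f(y); here f is
      \<open>\<phi>\<close> after the action of n^-1, and y is n applied to w.\<close>
    have "(\<Sum>b\<in>B. \<phi> (\<pi> (inv\<^bsub>K\<^esub> n) b) * ?R (\<pi> n w) b) =
        \<phi> (\<pi> (inv\<^bsub>K\<^esub> n) (\<Sum>b\<in>B. s (?R (\<pi> n w) b) b))"
      by (simp add: \<pi>n.sum \<pi>n.scale \<phi>.sum \<phi>.scale mult.commute)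
    also have "\<dots> = \<phi> w"
    proof -
      have "\<pi> (inv\<^bsub>K\<^esub> n) \<circ> \<pi> n = id"
        using \<pi> n unfolding group_representation_def by (metis inv_closed l_inv)
      then have "\<pi> (inv\<^bsub>K\<^esub> n) (\<pi> n w) = w" by (simp add: pointfree_idE)
      then show ?thesis by (simp add: Rsum)
    qed
    finally show "(\<Sum>b\<in>B. \<phi> (\<pi> (inv\<^bsub>K\<^esub> n) b) * ?R (\<pi> n w) b) = \<phi> w" .
  qed
  finally show ?thesis by (simp add: z)
qed

text \<open>Each coordinate functional contributes |K| times one component of w, and these
  contributions add up to |K| w. Hence the normalised character sum is the identity on the
  irreducible representation it belongs to.\<close>

lemma character_projection_irreducible:
  fixes s :: "complex \<Rightarrow> 'v::ab_group_add \<Rightarrow> 'v"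
  assumes K: "group K" and "finite (carrier K)" and fin: "finite_dimensional_vector_space s B"
    and irr: "irreducible_representation K s \<pi>"
  shows "s (of_nat (card B) / of_nat (card (carrier K)))
      (\<Sum>n\<in>carrier K. s (trace_in s B (\<pi> (inv\<^bsub>K\<^esub> n))) (\<pi> n w)) = w"
proof -
  interpret group K by fact
  interpret finite_dimensional_vector_space s B by fact
  let ?N = "of_nat (card (carrier K)) :: complex"
  have N: "?N \<noteq> 0" using assms(2) by auto
  have "s (of_nat (card B)) (\<Sum>n\<in>carrier K. s (trace_in s B (\<pi> (inv\<^bsub>K\<^esub> n))) (\<pi> n w)) =
      (\<Sum>b\<in>B. s (?N * representation B w b) b)"
    by (simp add: sum_character_scale[OF vector_space_axioms finite_Basis] scale_sum_right
        rank_one_average_irreducible[OF K fin irr linear_coordinate[OF fin]])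
  also have "\<dots> = s ?N (\<Sum>b\<in>B. s (representation B w b) b)"
    by (simp add: scale_sum_right)
  also have "\<dots> = s ?N w"
    using sum_representation_eq[OF independent_Basis _ finite_Basis order_refl] by (simp add: span_Basis)
  finally have "s (inverse ?N) (s (of_nat (card B)) (\<Sum>n\<in>carrier K. s (trace_in s B (\<pi> (inv\<^bsub>K\<^esub> n))) (\<pi> n w)))
      = s (inverse ?N) (s ?N w)" by simp
  then show ?thesis using N by (simp add: divide_inverse mult.commute)
qed

section \<open>Comodules of the double\<close>

locale finite_group = group G for G (structure) +
  assumes finite_carrier: "finite (carrier G)"
begin

lemma conj_inv_eq_iff:
  assumes "g \<in> carrier G" "h \<in> carrier G" "k \<in> carrier G"
  shows "g \<otimes> h \<otimes> inv g = k \<longleftrightarrow> h = inv g \<otimes> k \<otimes> g"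
  using assms by (metis inv_closed inv_solve_left inv_solve_right m_assoc m_closed)

text \<open>The definition lists the summands of the coproduct of a given basis element. Solving u =
  f^-1 x for x shows that a pair of basis elements occurs in the coproduct of at most one basis
  element, so sums over x in the comodule axioms collapse.\<close>

lemma bcomult_Dvee:
  assumes "x \<in> carrier G" "y \<in> carrier G"
  shows "bcomult (Dvee G) (x, y) (f, k) (u, h) =
    (if f \<in> carrier G \<and> u \<in> carrier G \<and> y = h \<and> x = f \<otimes> u \<and> k = u \<otimes> h \<otimes> inv u then 1 else 0)"
proof -
  have iff: "f \<in> carrier G \<and> u = inv f \<otimes> x \<and> h = y \<and> k = inv f \<otimes> x \<otimes> y \<otimes> inv x \<otimes> f \<longleftrightarrow>
      f \<in> carrier G \<and> u \<in> carrier G \<and> y = h \<and> x = f \<otimes> u \<and> k = u \<otimes> h \<otimes> inv u"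
  proof (cases "f \<in> carrier G")
    case True
    then have "inv f \<otimes> x \<otimes> y \<otimes> inv x \<otimes> f = (inv f \<otimes> x) \<otimes> y \<otimes> inv (inv f \<otimes> x)"
      using assms by (simp add: inv_mult_group m_assoc)
    moreover have "u = inv f \<otimes> x \<longleftrightarrow> u \<in> carrier G \<and> x = f \<otimes> u"
      using True assms by (metis inv_closed inv_solve_left m_closed)
    ultimately show ?thesis by auto
  qed simp
  have "bcomult (Dvee G) (x, y) (f, k) (u, h) =
      (\<Sum>f'\<in>carrier G. if f' = f then
        (if u = inv f \<otimes> x \<and> h = y \<and> k = inv f \<otimes> x \<otimes> y \<otimes> inv x \<otimes> f then 1 else 0) else 0)"
    unfolding Dvee_def dvee_over_def
    by (simp only: based_bialgebra.simps case_prod_conv sum_fun_apply)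
      (rule sum.cong, auto simp: tens_apply)
  also have "\<dots> = (if f \<in> carrier G \<and> u = inv f \<otimes> x \<and> h = y \<and> k = inv f \<otimes> x \<otimes> y \<otimes> inv x \<otimes> f
      then 1 else 0)"
    by (simp add: sum.delta[OF finite_carrier])
  finally show ?thesis unfolding iff .
qed

lemma bbasis_Dvee [simp]: "bbasis (Dvee G) = carrier G \<times> carrier G"
  by (simp add: Dvee_def dvee_over_def)

lemma sum_bcomult_Dvee:
  assumes "vector_space s"
  shows "(\<Sum>x\<in>carrier G \<times> carrier G. s (bcomult (Dvee G) x (f, k) (u, h)) (F x)) =
    (if f \<in> carrier G \<and> u \<in> carrier G \<and> h \<in> carrier G \<and> k = u \<otimes> h \<otimes> inv u
     then F (f \<otimes> u, h) else 0)"
proof -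
  interpret vector_space s by fact
  have "(\<Sum>x\<in>carrier G \<times> carrier G. s (bcomult (Dvee G) x (f, k) (u, h)) (F x)) =
      (\<Sum>x\<in>carrier G \<times> carrier G. if x = (f \<otimes> u, h) then
         (if f \<in> carrier G \<and> u \<in> carrier G \<and> k = u \<otimes> h \<otimes> inv u then F x else 0) else 0)"
    by (rule sum.cong) (auto simp: bcomult_Dvee split: if_splits)
  then show ?thesis using finite_carrier by (auto simp: sum.delta)
qed

lemma sum_bcounit_Dvee:
  assumes "vector_space s"
  shows "(\<Sum>x\<in>carrier G \<times> carrier G. s (bcounit (Dvee G) x) (F x)) = (\<Sum>h\<in>carrier G. F (\<one>, h))"
proof -
  interpret vector_space s by fact
  have "(\<Sum>x\<in>carrier G \<times> carrier G. s (bcounit (Dvee G) x) (F x)) =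
      (\<Sum>g\<in>carrier G. \<Sum>h\<in>carrier G. if g = \<one> then F (g, h) else 0)"
    by (auto simp: sum.cartesian_product Dvee_def dvee_over_def intro!: sum.cong)
  also have "\<dots> = (\<Sum>h\<in>carrier G. F (\<one>, h))"
    using finite_carrier by (subst sum.swap) (simp add: sum.delta)
  finally show ?thesis .
qed

lemma coproduct_coaction_Dvee:
  assumes "vector_space s"
  shows "coproduct_coaction (Dvee G) s t (f, k) (u, h) =
    (if f \<in> carrier G \<and> u \<in> carrier G \<and> h \<in> carrier G \<and> k = u \<otimes> h \<otimes> inv u
     then t (f \<otimes> u, h) else 0)"
  unfolding coproduct_coaction_def by (simp add: sum_bcomult_Dvee[OF assms])

text \<open>Coassociativity comes down to associativity in the group and to the fact that
  conjugating by u v is conjugating by v and then by u.\<close>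

lemma left_comodule_coproduct:
  fixes s :: "complex \<Rightarrow> 'v::ab_group_add \<Rightarrow> 'v"
  assumes "vector_space s"
  shows "left_comodule (Dvee G) (fscale s) (tensor_space (carrier G \<times> carrier G))
    (coproduct_coaction (Dvee G) s)"
proof -
  interpret V: vector_space s by fact
  interpret FV: vector_space "fscale s" by (rule vector_space_fscale) fact
  note L = coproduct_coaction_Dvee[OF assms]
  let ?L = "coproduct_coaction (Dvee G) s"
  let ?M = "tensor_space (carrier G \<times> carrier G) :: ('a \<times> 'a \<Rightarrow> 'v) set"
  have in_M: "?L t a \<in> ?M" for t a
    by (cases a) (auto simp: tensor_space_def L)
  have "linear_on (fscale s) ?M (fscale (fscale s)) (tensor_space (carrier G \<times> carrier G)) ?L"
    unfolding linear_on_def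
  proof (intro conjI ballI allI)
    fix t assume "t \<in> ?M"
    show "?L t \<in> tensor_space (carrier G \<times> carrier G)"
      by (auto simp: tensor_space_def fun_eq_iff L)
  qed (auto simp: fun_eq_iff fscale_apply L)
  moreover have "?L (?L t a) b =
      (\<Sum>x\<in>carrier G \<times> carrier G. fscale s (bcomult (Dvee G) x a b) (?L t x))"
    if ab: "a \<in> carrier G \<times> carrier G" "b \<in> carrier G \<times> carrier G" for t a b
  proof -
    obtain f k u h where [simp]: "a = (f, k)" "b = (u, h)" by (cases a, cases b) auto
    have "?L (?L t a) b (v, l) =
        (if k = u \<otimes> h \<otimes> inv u then ?L t (f \<otimes> u, h) else 0) (v, l)" for v l
    proof (cases "v \<in> carrier G \<and> l \<in> carrier G \<and> h = v \<otimes> l \<otimes> inv v")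
      case True
      then have "(u \<otimes> v) \<otimes> l \<otimes> inv (u \<otimes> v) = u \<otimes> h \<otimes> inv u"
        using ab by (simp add: m_assoc inv_mult_group)
      then show ?thesis using ab True by (auto simp: L m_assoc)
    qed (auto simp: L)
    then show ?thesis
      using ab by (simp add: sum_bcomult_Dvee[OF FV.vector_space_axioms] fun_eq_iff)
  qed
  moreover have "(\<Sum>x\<in>carrier G \<times> carrier G. fscale s (bcounit (Dvee G) x) (?L t x)) = t"
    if "t \<in> ?M" for t
  proof
    fix y :: "'a \<times> 'a"
    obtain u h where [simp]: "y = (u, h)" by (cases y)
    \<comment> \<open>The counit fixes the first label to be the identity; the sum over k then meets
      the single value u h u^-1 at which the coaction can be nonzero.\<close>
    have "(\<Sum>k\<in>carrier G. ?L t (\<one>, k) (u, h)) = (\<Sum>k\<in>carrier G. if k = u \<otimes> h \<otimes> inv u then t (u, h) else 0)"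
      using that by (intro sum.cong) (auto simp: L tensor_space_def)
    also have "\<dots> = t (u, h)" using that finite_carrier by (auto simp: sum.delta tensor_space_def)
    finally show "(\<Sum>x\<in>carrier G \<times> carrier G. fscale s (bcounit (Dvee G) x) (?L t x)) y = t y"
      by (simp add: sum_bcounit_Dvee[OF FV.vector_space_axioms] sum_fun_apply)
  qed
  ultimately show ?thesis
    unfolding left_comodule_def using FV.vector_space_axioms in_M
    by (simp add: subspace_tensor_space[OF assms])
qed

end

section \<open>Crossed modules underlying right comodules, and the coaction on the group algebra
  tensor W\<close>

locale crossed_module = finite_group G for G (structure) +
  fixes s :: "complex \<Rightarrow> 'w::ab_group_add \<Rightarrow> 'w" and \<rho> :: "'w \<Rightarrow> 'a \<times> 'a \<Rightarrow> 'w"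
  assumes comodule: "right_comodule (Dvee G) s UNIV \<rho>"
begin

abbreviation act where "act \<equiv> cm_act G \<rho>"
abbreviation part where "part \<equiv> cm_part G \<rho>"

sublocale W: vector_space s
  using comodule by (simp add: right_comodule_def)

lemma rho_linear: "linear_on s UNIV (fscale s) (tensor_space (carrier G \<times> carrier G)) \<rho>"
  using comodule by (simp add: right_comodule_def)

lemma rho_add: "\<rho> (v + w) = \<rho> v + \<rho> w" and rho_scale: "\<rho> (s c w) = fscale s c (\<rho> w)"
  and rho_outside: "x \<notin> carrier G \<times> carrier G \<Longrightarrow> \<rho> w x = 0"
  using rho_linear unfolding linear_on_def tensor_space_def by blast+

lemma linear_rho: "Vector_Spaces.linear s s (\<lambda>w. \<rho> w x)"
  by unfold_locales (simp_all add: rho_add rho_scale fscale_apply)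

lemma linear_part: "Vector_Spaces.linear s s (part h)"
  using linear_rho[of "(\<one>, h)"] by (simp add: cm_part_def[abs_def])

lemma linear_act: "Vector_Spaces.linear s s (act g)"
  by unfold_locales
    (simp_all add: cm_act_def rho_add rho_scale fscale_apply sum.distrib W.scale_sum_right)

text \<open>The index ranges over the whole type: off the group all components of the coaction are
  zero, so there the maps are zero and still linear.\<close>

sublocale act: Vector_Spaces.linear s s "act g" for g
  by (rule linear_act)

sublocale part: Vector_Spaces.linear s s "part h" for h
  by (rule linear_part)

lemmas act_one = right_comodule_Dvee(4)[OF is_group finite_carrier comodule]
lemmas act_act = right_comodule_Dvee(5)[OF is_group finite_carrier comodule]
lemmas part_part = right_comodule_Dvee(3)[OF is_group finite_carrier comodule]
lemmas act_part = right_comodule_Dvee(6)[OF is_group finite_carrier comodule]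

lemma rho_eq:
  assumes "g \<in> carrier G" "h \<in> carrier G"
  shows "\<rho> w (g, h) = act g (part h w)"
proof -
  have "\<rho> w (g, h) = (\<Sum>x\<in>carrier G \<times> carrier G. if x = (g, h) then act (fst x) (part (snd x) w) else 0)"
    by (subst right_comodule_Dvee(1)[OF is_group finite_carrier comodule])
      (auto simp: sum_fun_apply tens_apply sum.cartesian_product intro!: sum.cong)
  then show ?thesis using assms finite_carrier by (simp add: sum.delta)
qed

lemma act_inv [simp]:
  assumes "g \<in> carrier G"
  shows "act (inv g) (act g w) = w" and "act g (act (inv g) w) = w"
  using assms by (simp_all add: act_act act_one)

lemma group_representation_act:
  assumes "subgroup H G"
  shows "group_representation (G\<lparr>carrier := H\<rparr>) s act"
  using subgroup.subset[OF assms]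
  by (auto simp: group_representation_def linear_act act_one fun_eq_iff act_act subset_iff)

text \<open>Solving k = f^-1 g f for g leaves at most one term of the double sum.\<close>

lemma Delta_L_apply:
  "Delta_L G \<rho> t (f, k) y =
    (if f \<in> carrier G \<and> k \<in> carrier G \<and> y = k then act (inv f) (t (f \<otimes> k \<otimes> inv f)) else 0)"
proof -
  have "Delta_L G \<rho> t (f, k) y = (\<Sum>g\<in>carrier G. \<Sum>f'\<in>carrier G. if f' = f then
      (if k = inv f \<otimes> g \<otimes> f \<and> y = k then act (inv f) (t g) else 0) else 0)"
    unfolding Delta_L_def sum_fun_apply by (intro sum.cong) (auto simp: tens_apply)
  also have "\<dots> = (\<Sum>g\<in>carrier G. if g = f \<otimes> k \<otimes> inv f then
      (if f \<in> carrier G \<and> k \<in> carrier G \<and> y = k then act (inv f) (t g) else 0) else 0)"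
  proof (rule sum.cong[OF refl])
    fix g assume "g \<in> carrier G"
    then have iff: "f \<in> carrier G \<and> k = inv f \<otimes> g \<otimes> f \<longleftrightarrow>
        g = f \<otimes> k \<otimes> inv f \<and> f \<in> carrier G \<and> k \<in> carrier G"
      using conj_inv_eq_iff[of f k g] by auto
    \<comment> \<open>The equation in the inner sum has g conjugated. Exchanging equivalent
      conditions isolates g, which is the shape on which the outer sum collapses.\<close>
    have if_swap: "(if A then if B \<and> Y then X else 0 else 0) = (if C then if A \<and> D \<and> Y then X else 0 else (0::'w))"
      if "A \<and> B \<longleftrightarrow> C \<and> A \<and> D" for A B C D Y X
      using that by auto
    show "(\<Sum>f'\<in>carrier G. if f' = f then
        (if k = inv f \<otimes> g \<otimes> f \<and> y = k then act (inv f) (t g) else 0) else 0) =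
      (if g = f \<otimes> k \<otimes> inv f then
        (if f \<in> carrier G \<and> k \<in> carrier G \<and> y = k then act (inv f) (t g) else 0) else 0)"
      unfolding sum.delta[OF finite_carrier] by (rule if_swap[OF iff])
  qed
  finally show ?thesis using finite_carrier by (auto simp: sum.delta)
qed

text \<open>Coassociativity holds since conjugation by f u is iterated conjugation and the inverses
  act in the opposite order; the counit axiom holds since the identity acts trivially.\<close>

lemma left_comodule_Delta_L:
  "left_comodule (Dvee G) (fscale s) (tensor_space (carrier G)) (Delta_L G \<rho>)"
proof -
  interpret FW: vector_space "fscale s" by (rule vector_space_fscale) (rule W.vector_space_axioms)
  let ?L = "Delta_L G \<rho>"
  let ?M = "tensor_space (carrier G) :: ('a \<Rightarrow> 'w) set"
  have in_M: "?L t a \<in> ?M" for t a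
    by (cases a) (auto simp: tensor_space_def Delta_L_apply)
  have "linear_on (fscale s) ?M (fscale (fscale s)) (tensor_space (carrier G \<times> carrier G)) ?L"
    unfolding linear_on_def
  proof (intro conjI ballI allI)
    fix t assume "t \<in> ?M"
    show "?L t \<in> tensor_space (carrier G \<times> carrier G)"
      by (auto simp: tensor_space_def fun_eq_iff Delta_L_apply)
  qed (auto simp: fun_eq_iff fscale_apply Delta_L_apply act.add act.scale)
  moreover have "?L (?L t a) b =
      (\<Sum>x\<in>carrier G \<times> carrier G. fscale s (bcomult (Dvee G) x a b) (?L t x))"
    if ab: "a \<in> carrier G \<times> carrier G" "b \<in> carrier G \<times> carrier G" for t a b
  proof -
    obtain f k u h where [simp]: "a = (f, k)" "b = (u, h)" by (cases a, cases b) auto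
    have "?L (?L t a) b y = (if k = u \<otimes> h \<otimes> inv u then ?L t (f \<otimes> u, h) else 0) y" for y
    proof (cases "y = h \<and> k = u \<otimes> h \<otimes> inv u")
      case True
      then have "f \<otimes> u \<otimes> h \<otimes> inv (f \<otimes> u) = f \<otimes> k \<otimes> inv f"
        using ab by (simp add: m_assoc inv_mult_group)
      then show ?thesis using ab True by (simp add: Delta_L_apply act_act inv_mult_group)
    qed (use ab in \<open>auto simp: Delta_L_apply\<close>)
    then show ?thesis
      using ab by (simp add: sum_bcomult_Dvee[OF FW.vector_space_axioms] fun_eq_iff)
  qed
  moreover have "(\<Sum>x\<in>carrier G \<times> carrier G. fscale s (bcounit (Dvee G) x) (?L t x)) = t"
    if "t \<in> ?M" for t
  proof
    fix y
    have "(\<Sum>k\<in>carrier G. ?L t (\<one>, k) y) = (\<Sum>k\<in>carrier G. if k = y then t y else 0)"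
      by (intro sum.cong) (auto simp: Delta_L_apply act_one)
    also have "\<dots> = t y" using that finite_carrier by (auto simp: sum.delta tensor_space_def)
    finally show "(\<Sum>x\<in>carrier G \<times> carrier G. fscale s (bcounit (Dvee G) x) (?L t x)) y = t y"
      by (simp add: sum_bcounit_Dvee[OF FW.vector_space_axioms] sum_fun_apply)
  qed
  ultimately show ?thesis
    unfolding left_comodule_def using FW.vector_space_axioms in_M
    by (simp add: subspace_tensor_space[OF W.vector_space_axioms])
qed

end

section \<open>Centralisers, and conjugation by group elements inside the quantum double\<close>

context finite_group
begin

lemma mem_centraliser_iff:
  assumes "r \<in> carrier G"
  shows "n \<in> centraliser G r \<longleftrightarrow> n \<in> carrier G \<and> n \<otimes> r \<otimes> inv n = r"
  using assms by (simp add: centraliser_def stabilizer_def conj_action_def)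

lemma subgroup_centraliser:
  assumes "r \<in> carrier G"
  shows "subgroup (centraliser G r) G"
proof
  show "centraliser G r \<subseteq> carrier G" using assms by (auto simp: mem_centraliser_iff)
  show "\<one> \<in> centraliser G r" using assms by (simp add: mem_centraliser_iff)
  fix m assume m: "m \<in> centraliser G r"
  then show "inv m \<in> centraliser G r"
    using assms by (auto simp: mem_centraliser_iff conj_inv_eq_iff)
  fix n assume n: "n \<in> centraliser G r"
  have "m \<in> carrier G" "n \<in> carrier G" using m n assms by (simp_all add: mem_centraliser_iff)
  then have "m \<otimes> n \<otimes> r \<otimes> inv (m \<otimes> n) = m \<otimes> (n \<otimes> r \<otimes> inv n) \<otimes> inv m"
    using assms by (simp add: inv_mult_group m_assoc)
  then show "m \<otimes> n \<in> centraliser G r"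
    using m n assms by (simp add: mem_centraliser_iff)
qed

lemma double_of_group_apply:
  "double_of_group G a (g, h) = (if g \<in> carrier G \<and> h = a then 1 else 0)"
proof -
  have "double_of_group G a (g, h) = (\<Sum>g'\<in>carrier G. if g = g' then (if h = a then 1 else 0) else 0)"
    unfolding double_of_group_def sum_fun_apply by (intro sum.cong) (auto simp: tens_apply)
  then show ?thesis using finite_carrier by (auto simp: sum.delta)
qed

text \<open>The group element fixes one label of the left factor, and the product rule then
  determines all the others; multiplication by a is a change of coordinates.\<close>

lemma double_mult_of_group_left:
  assumes a: "a \<in> carrier G"
  shows "double_mult G (double_of_group G a) x (g, h) =
    (if g \<in> carrier G \<and> h \<in> carrier G then x (inv a \<otimes> g \<otimes> a, inv a \<otimes> h) else 0)"
proof -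
  let ?S = "carrier G \<times> carrier G"
  have "double_mult G (double_of_group G a) x (g, h) =
      (\<Sum>p\<in>?S. \<Sum>p'\<in>?S. if p = (g, a) then
        (if p' = (inv a \<otimes> g \<otimes> a, inv a \<otimes> h) then (if h \<in> carrier G then x p' else 0) else 0) else 0)"
    unfolding double_mult_def
  proof (intro sum.cong refl, clarify, intro sum.cong refl, clarify)
    fix g1 h1 u v
    assume S: "g1 \<in> carrier G" "h1 \<in> carrier G" "u \<in> carrier G" "v \<in> carrier G"
    have "g1 = a \<otimes> u \<otimes> inv a \<longleftrightarrow> u = inv a \<otimes> g1 \<otimes> a"
      using conj_inv_eq_iff[OF a S(3) S(1)] by auto
    moreover have "h = a \<otimes> v \<longleftrightarrow> v = inv a \<otimes> h \<and> h \<in> carrier G"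
      using a S by (metis inv_solve_left m_closed)
    ultimately show "double_of_group G a (g1, h1) * x (u, v) *
        (if g1 = h1 \<otimes> u \<otimes> inv h1 then ket (g1, h1 \<otimes> v) (g, h) else 0) =
      (if (g1, h1) = (g, a) then if (u, v) = (inv a \<otimes> g \<otimes> a, inv a \<otimes> h)
        then if h \<in> carrier G then x (u, v) else 0 else 0 else 0)"
      using S by (auto simp: double_of_group_apply tens_apply)
  qed
  also have "\<dots> = (\<Sum>p\<in>?S. if p = (g, a) then
      (if g \<in> carrier G \<and> h \<in> carrier G then x (inv a \<otimes> g \<otimes> a, inv a \<otimes> h) else 0) else 0)"
    using a finite_carrier by (intro sum.cong refl) (auto simp: sum.delta)
  finally show ?thesis using a finite_carrier by (auto simp: sum.delta)
qed

lemma double_mult_of_group_right: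
  assumes b: "b \<in> carrier G"
  shows "double_mult G x (double_of_group G b) (g, h) =
    (if g \<in> carrier G \<and> h \<in> carrier G then x (g, h \<otimes> inv b) else 0)"
proof -
  let ?S = "carrier G \<times> carrier G"
  have "double_mult G x (double_of_group G b) (g, h) =
      (\<Sum>p\<in>?S. \<Sum>p'\<in>?S. if p' = (inv (snd p) \<otimes> fst p \<otimes> snd p, b) then
        (if p = (g, h \<otimes> inv b) then (if h \<in> carrier G then x p else 0) else 0) else 0)"
    unfolding double_mult_def
  proof (intro sum.cong refl, clarify, intro sum.cong refl, clarify)
    fix g1 h1 u v
    assume S: "g1 \<in> carrier G" "h1 \<in> carrier G" "u \<in> carrier G" "v \<in> carrier G"
    have "g1 = h1 \<otimes> u \<otimes> inv h1 \<longleftrightarrow> u = inv h1 \<otimes> g1 \<otimes> h1"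
      using conj_inv_eq_iff[OF S(2,3,1)] by auto
    moreover have "h = h1 \<otimes> b \<longleftrightarrow> h1 = h \<otimes> inv b \<and> h \<in> carrier G"
      using b S by (metis inv_solve_right m_closed)
    ultimately show "x (g1, h1) * double_of_group G b (u, v) *
        (if g1 = h1 \<otimes> u \<otimes> inv h1 then ket (g1, h1 \<otimes> v) (g, h) else 0) =
      (if (u, v) = (inv (snd (g1, h1)) \<otimes> fst (g1, h1) \<otimes> snd (g1, h1), b)
        then if (g1, h1) = (g, h \<otimes> inv b) then if h \<in> carrier G then x (g1, h1) else 0 else 0 else 0)"
      using S by (auto simp: double_of_group_apply tens_apply)
  qed
  also have "\<dots> = (\<Sum>p\<in>?S. if p = (g, h \<otimes> inv b) then (if h \<in> carrier G then x p else 0) else 0)"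
    using b finite_carrier by (intro sum.cong refl) (auto simp: sum.delta)
  finally show ?thesis using b finite_carrier by (auto simp: sum.delta)
qed

end

context crossed_module
begin

text \<open>Conjugating by a amounts to transport of structure: go back by a^-1, take the degree r
  part, apply the weighted sum over the centraliser, and return by a. The weights are arbitrary here
  and become the character weights later.\<close>

lemma double_act_conjugate:
  assumes r: "r \<in> carrier G" and a: "a \<in> carrier G"
    and P: "\<And>n. n \<notin> centraliser G r \<Longrightarrow> P n = 0"
  shows "double_act G s \<rho>
      (double_mult G (double_mult G (double_of_group G a) (\<lambda>(g, n). ket r g * P n))
        (double_of_group G (inv a))) w =
    act a (\<Sum>n\<in>centraliser G r. s (P n) (act n (part r (act (inv a) w))))"
proof -
  let ?S = "carrier G \<times> carrier G"
  let ?c = "a \<otimes> r \<otimes> inv a"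
  let ?X = "double_mult G (double_mult G (double_of_group G a) (\<lambda>(g, n). ket r g * P n))
        (double_of_group G (inv a))"
  have K: "centraliser G r \<subseteq> carrier G" using subgroup.subset[OF subgroup_centraliser[OF r]] .
  \<comment> \<open>The conjugated element lives over the single degree a r a^-1, with its weights
    moved along n \<mapsto> a n a^-1.\<close>
  have X: "?X (g, h) = (if g = ?c then P (inv a \<otimes> h \<otimes> a) else 0)"
    if "g \<in> carrier G" "h \<in> carrier G" for g h
    using that a r conj_inv_eq_iff[OF a r that(1)]
    by (auto simp: double_mult_of_group_left double_mult_of_group_right tens_apply m_assoc)
  have "double_act G s \<rho> ?X w = (\<Sum>p\<in>?S. if fst p = ?c then
      s (P (inv a \<otimes> snd p \<otimes> a)) (act (snd p) (part (inv (snd p) \<otimes> ?c \<otimes> snd p) w)) else 0)"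
    unfolding double_act_def
  proof (intro sum.cong refl, clarify)
    fix g h assume S: "g \<in> carrier G" "h \<in> carrier G"
    have "(\<Sum>k\<in>carrier G. if g = h \<otimes> k \<otimes> inv h then act h (part k w) else 0) =
        (\<Sum>k\<in>carrier G. if k = inv h \<otimes> g \<otimes> h then act h (part k w) else 0)"
    proof (rule sum.cong[OF refl])
      fix k assume "k \<in> carrier G"
      then have "g = h \<otimes> k \<otimes> inv h \<longleftrightarrow> k = inv h \<otimes> g \<otimes> h"
        using conj_inv_eq_iff[OF S(2) _ S(1)] by metis
      then show "(if g = h \<otimes> k \<otimes> inv h then act h (part k w) else 0) =
          (if k = inv h \<otimes> g \<otimes> h then act h (part k w) else 0)" by (rule if_cong) auto
    qed
    also have "\<dots> = act h (part (inv h \<otimes> g \<otimes> h) w)"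
      using S finite_carrier by (simp add: sum.delta)
    finally show "s (?X (g, h)) (\<Sum>k\<in>carrier G. if g = h \<otimes> k \<otimes> inv h then act h (part k w) else 0) =
      (if fst (g, h) = ?c then s (P (inv a \<otimes> snd (g, h) \<otimes> a))
        (act (snd (g, h)) (part (inv (snd (g, h)) \<otimes> ?c \<otimes> snd (g, h)) w)) else 0)"
      using S by (simp add: X)
  qed
  also have "\<dots> = (\<Sum>g\<in>carrier G. if g = ?c then
      (\<Sum>h\<in>carrier G. s (P (inv a \<otimes> h \<otimes> a)) (act h (part (inv h \<otimes> ?c \<otimes> h) w))) else 0)"
    by (subst sum.cartesian_product') (auto intro!: sum.cong)
  also have "\<dots> = (\<Sum>h\<in>carrier G. s (P (inv a \<otimes> h \<otimes> a)) (act h (part (inv h \<otimes> ?c \<otimes> h) w)))"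
    using a r finite_carrier by (simp add: sum.delta)
  also have "\<dots> = (\<Sum>n\<in>carrier G. s (P n)
      (act (a \<otimes> n \<otimes> inv a) (part (inv (a \<otimes> n \<otimes> inv a) \<otimes> ?c \<otimes> (a \<otimes> n \<otimes> inv a)) w)))"
  proof (rule sum.reindex_bij_witness[where i = "\<lambda>n. a \<otimes> n \<otimes> inv a" and j = "\<lambda>h. inv a \<otimes> h \<otimes> a"])
    fix h assume h: "h \<in> carrier G"
    then have "a \<otimes> (inv a \<otimes> h \<otimes> a) \<otimes> inv a = h"
      using a by (simp add: conj_inv_eq_iff)
    then show "a \<otimes> (inv a \<otimes> h \<otimes> a) \<otimes> inv a = h"
      "s (P (inv a \<otimes> h \<otimes> a)) (act (a \<otimes> (inv a \<otimes> h \<otimes> a) \<otimes> inv a)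
        (part (inv (a \<otimes> (inv a \<otimes> h \<otimes> a) \<otimes> inv a) \<otimes> ?c \<otimes> (a \<otimes> (inv a \<otimes> h \<otimes> a) \<otimes> inv a)) w)) =
       s (P (inv a \<otimes> h \<otimes> a)) (act h (part (inv h \<otimes> ?c \<otimes> h) w))"
      by simp_all
  next
    fix n assume "n \<in> carrier G"
    then show "inv a \<otimes> (a \<otimes> n \<otimes> inv a) \<otimes> a = n" using a by (metis conj_inv_eq_iff inv_closed m_closed)
  qed (use a in simp_all)
  also have "\<dots> = (\<Sum>n\<in>centraliser G r. act a (s (P n) (act n (part r (act (inv a) w)))))"
  proof (rule sum.mono_neutral_cong_right[OF finite_carrier K])
    fix n assume n: "n \<in> centraliser G r"
    then have nG: "n \<in> carrier G" using K by blast
    have "n \<otimes> r \<otimes> inv n = r" using n r by (simp add: mem_centraliser_iff)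
    \<comment> \<open>As a n a^-1 commutes with a r a^-1, every remaining summand extracts the same
      part of w, the one of degree a r a^-1.\<close>
    then have "(a \<otimes> n \<otimes> inv a) \<otimes> ?c \<otimes> inv (a \<otimes> n \<otimes> inv a) = ?c"
    proof -
      have "(a \<otimes> n \<otimes> inv a) \<otimes> ?c \<otimes> inv (a \<otimes> n \<otimes> inv a) = a \<otimes> (n \<otimes> r \<otimes> inv n) \<otimes> inv a"
        using a nG r by (simp add: m_assoc inv_mult_group) (simp add: m_assoc[symmetric])
      then show ?thesis using \<open>n \<otimes> r \<otimes> inv n = r\<close> by simp
    qed
    then have "inv (a \<otimes> n \<otimes> inv a) \<otimes> ?c \<otimes> (a \<otimes> n \<otimes> inv a) = ?c"
      using conj_inv_eq_iff[of "a \<otimes> n \<otimes> inv a" ?c ?c] a nG r by simp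
    moreover have "part ?c w = act a (part r (act (inv a) w))"
      using a r by (simp add: act_part)
    moreover have "act (a \<otimes> n \<otimes> inv a) (act a v) = act a (act n v)" for v
      using a nG by (simp add: act_act m_assoc)
    ultimately show "s (P n) (act (a \<otimes> n \<otimes> inv a)
        (part (inv (a \<otimes> n \<otimes> inv a) \<otimes> ?c \<otimes> (a \<otimes> n \<otimes> inv a)) w)) =
      act a (s (P n) (act n (part r (act (inv a) w))))"
      by (simp add: act.scale)
  qed (auto simp: P)
  finally show ?thesis by (simp add: act.sum)
qed

end

section \<open>Invariants as sections over the conjugacy class\<close>

context finite_group
begin

lemma V_coaction_apply:
  assumes "r \<in> carrier G"
  shows "V_coaction G r \<pi> v (u, m) = (if u \<in> centraliser G r \<and> m = r then \<pi> u v else 0)"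
proof -
  have "V_coaction G r \<pi> v (u, m) =
      (\<Sum>u'\<in>centraliser G r. if u' = u then (if m = r then \<pi> u v else 0) else 0)"
    unfolding V_coaction_def sum_fun_apply by (intro sum.cong) (auto simp: tens_apply)
  then show ?thesis
    using finite_subset[OF subgroup.subset[OF subgroup_centraliser[OF assms]] finite_carrier]
    by (simp add: sum.delta)
qed

text \<open>The projection is the identity on labels in the centraliser, the product of H forces
  both factors to carry the same function label k, and V sits in degree r. So the factor coming from
  \<open>Dvee G\<close> must be \<open>(k, l \<otimes> inv r)\<close>.\<close>

lemma tensor_coaction_Hquot:
  assumes r: "r \<in> carrier G" and s: "vector_space s"
    and k: "k \<in> centraliser G r" and l: "l \<in> carrier G"
  shows "tensor_coaction (Dvee G) (Hquot G r) (Hproj G r) s (V_coaction G r \<pi>) t (k, l) (g, h) =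
    (if g \<in> carrier G \<and> h = k \<otimes> (l \<otimes> inv r) \<otimes> inv k then \<pi> k (t (g \<otimes> k, l \<otimes> inv r)) else 0)"
proof -
  interpret vector_space s by fact
  let ?S = "carrier G \<times> carrier G" and ?K = "centraliser G r \<times> carrier G"
  have K: "centraliser G r \<subseteq> carrier G" using subgroup.subset[OF subgroup_centraliser[OF r]] .
  then have fin: "finite ?K" "?K \<subseteq> ?S" using finite_carrier by (auto intro: finite_subset)
  have kG: "k \<in> carrier G" using k K by blast
  have basis: "bbasis (Hquot G r) = ?K" by (simp add: Hquot_def dvee_over_def)
  have mult: "bmult (Hquot G r) b1 b2 (k, l) =
      (if fst b1 = k \<and> fst b2 = k \<and> l = snd b1 \<otimes> snd b2 then 1 else 0)" for b1 b2
    by (auto simp: Hquot_def dvee_over_def tens_apply split: prod.splits)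
  have proj: "(\<Sum>z\<in>?S. bcomult (Dvee G) x y z * Hproj G r z b) = bcomult (Dvee G) x y b"
    if "b \<in> ?K" for x y b
  proof -
    have "(\<Sum>z\<in>?S. bcomult (Dvee G) x y z * Hproj G r z b) =
        (\<Sum>z\<in>?S. if z = b then bcomult (Dvee G) x y z else 0)"
      using that by (intro sum.cong refl) (auto simp: quotient_map_def tens_apply split: if_splits)
    then show ?thesis using that fin finite_carrier by (auto simp: sum.delta)
  qed
  have "tensor_coaction (Dvee G) (Hquot G r) (Hproj G r) s (V_coaction G r \<pi>) t (k, l) (g, h) =
      (\<Sum>x\<in>?S. \<Sum>b1\<in>?K. \<Sum>b2\<in>?K. if b2 = (k, r) then
        (if b1 = (k, l \<otimes> inv r) then s (bcomult (Dvee G) x (g, h) b1) (\<pi> k (t x)) else 0) else 0)"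
    unfolding tensor_coaction_def basis bbasis_Dvee
  proof (intro sum.cong refl)
    fix x b1 b2 assume b: "b1 \<in> ?K" "b2 \<in> ?K"
    have "l = snd b1 \<otimes> r \<longleftrightarrow> snd b1 = l \<otimes> inv r" using b r l by (auto simp: inv_solve_right m_assoc)
    then show "s ((\<Sum>z\<in>?S. bcomult (Dvee G) x (g, h) z * Hproj G r z b1) * bmult (Hquot G r) b1 b2 (k, l))
        (V_coaction G r \<pi> (t x) b2) =
      (if b2 = (k, r) then
        (if b1 = (k, l \<otimes> inv r) then s (bcomult (Dvee G) x (g, h) b1) (\<pi> k (t x)) else 0) else 0)"
      unfolding proj[OF b(1)] mult using b by (cases b1; cases b2) (auto simp: V_coaction_apply[OF r])
  qed
  also have "\<dots> = (\<Sum>x\<in>?S. s (bcomult (Dvee G) x (g, h) (k, l \<otimes> inv r)) (\<pi> k (t x)))"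
    using fin k r l by (simp add: sum.delta)
  finally show ?thesis using r kG l by (simp add: sum_bcomult_Dvee[OF s])
qed

text \<open>The unit of H is supported on l = 1. There k = 1 confines t to the second label r^-1,
  and general k gives the equivariance; at any other l both sides then vanish.\<close>

lemma mem_E_space_iff:
  assumes r: "r \<in> carrier G" and s: "vector_space s"
    and \<pi>: "group_representation (G\<lparr>carrier := centraliser G r\<rparr>) s \<pi>"
  shows "t \<in> E_space G r s \<pi> \<longleftrightarrow>
    t \<in> tensor_space (carrier G \<times> carrier G) \<and> (\<forall>g h. h \<noteq> inv r \<longrightarrow> t (g, h) = 0) \<and>
    (\<forall>g\<in>carrier G. \<forall>k\<in>centraliser G r. \<pi> k (t (g \<otimes> k, inv r)) = t (g, inv r))"
proof -
  interpret vector_space s by fact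
  let ?T = "tensor_coaction (Dvee G) (Hquot G r) (Hproj G r) s (V_coaction G r \<pi>)"
  have K: "centraliser G r \<subseteq> carrier G" using subgroup.subset[OF subgroup_centraliser[OF r]] .
  have basis: "bbasis (Hquot G r) = centraliser G r \<times> carrier G"
    by (simp add: Hquot_def dvee_over_def)
  have unit: "bunit (Hquot G r) (k, l) = (if l = \<one> then 1 else 0)" if "k \<in> centraliser G r" for k l
  proof -
    have "bunit (Hquot G r) (k, l) = (\<Sum>g\<in>centraliser G r. if g = k then (if l = \<one> then 1 else 0) else 0)"
      unfolding Hquot_def dvee_over_def
      by (simp only: based_bialgebra.simps sum_fun_apply) (auto simp: tens_apply intro!: sum.cong)
    then show ?thesis using that finite_subset[OF K finite_carrier] by (simp add: sum.delta)
  qed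
  \<comment> \<open>This makes the label condition at l = 1 the same for all k, namely h =
    r^-1.\<close>
  have conj: "k \<otimes> inv r \<otimes> inv k = inv r" if "k \<in> centraliser G r" for k
  proof -
    have kr: "k \<in> carrier G" "k \<otimes> r \<otimes> inv k = r" using that r by (simp_all add: mem_centraliser_iff)
    have "inv (k \<otimes> r \<otimes> inv k) = k \<otimes> inv r \<otimes> inv k" using kr(1) r by (simp add: inv_mult_group m_assoc)
    then show ?thesis using kr(2) by simp
  qed
  have \<pi>0: "\<pi> k 0 = 0" if "k \<in> centraliser G r" for k
  proof -
    interpret Vector_Spaces.linear s s "\<pi> k"
      using that \<pi> by (simp add: group_representation_def)
    show ?thesis by (rule zero)
  qed
  have one: "\<one> \<in> centraliser G r" using subgroup.one_closed[OF subgroup_centraliser[OF r]] .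
  have T1: "?T t (k, \<one>) (g, h) =
      (if g \<in> carrier G \<and> h = inv r then \<pi> k (t (g \<otimes> k, inv r)) else 0)"
    if "k \<in> centraliser G r" for k g h
    using that r by (simp add: tensor_coaction_Hquot[OF r s] conj)
  have E: "t \<in> E_space G r s \<pi> \<longleftrightarrow> t \<in> tensor_space (carrier G \<times> carrier G) \<and>
      (\<forall>k\<in>centraliser G r. \<forall>l\<in>carrier G. \<forall>g h. ?T t (k, l) (g, h) = (if l = \<one> then t (g, h) else 0))"
    unfolding E_space_def coinvariants_def
    by (simp add: basis fun_eq_iff fscale_apply unit if_distrib[of "\<lambda>c. s c _"] cong: if_cong)
  show ?thesis unfolding E
  proof (intro iffI conjI)
    assume L: "t \<in> tensor_space (carrier G \<times> carrier G) \<and>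
      (\<forall>k\<in>centraliser G r. \<forall>l\<in>carrier G. \<forall>g h. ?T t (k, l) (g, h) = (if l = \<one> then t (g, h) else 0))"
    then show "t \<in> tensor_space (carrier G \<times> carrier G)" ..
    have "t (g, h) = (if g \<in> carrier G \<and> h = inv r then \<pi> k (t (g \<otimes> k, inv r)) else 0)"
      if "k \<in> centraliser G r" for k g h
      using L[THEN conjunct2, rule_format, OF that one_closed, of g h] T1[OF that, of g h] by simp
    then show "\<forall>g h. h \<noteq> inv r \<longrightarrow> t (g, h) = 0"
      "\<forall>g\<in>carrier G. \<forall>k\<in>centraliser G r. \<pi> k (t (g \<otimes> k, inv r)) = t (g, inv r)"
      using one by auto
  next
    assume R: "t \<in> tensor_space (carrier G \<times> carrier G) \<and> (\<forall>g h. h \<noteq> inv r \<longrightarrow> t (g, h) = 0) \<and>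
      (\<forall>g\<in>carrier G. \<forall>k\<in>centraliser G r. \<pi> k (t (g \<otimes> k, inv r)) = t (g, inv r))"
    then show "t \<in> tensor_space (carrier G \<times> carrier G)" ..
    show "\<forall>k\<in>centraliser G r. \<forall>l\<in>carrier G. \<forall>g h. ?T t (k, l) (g, h) = (if l = \<one> then t (g, h) else 0)"
    proof (intro ballI allI)
      fix k l g h assume k: "k \<in> centraliser G r" and l: "l \<in> carrier G"
      show "?T t (k, l) (g, h) = (if l = \<one> then t (g, h) else 0)"
      proof (cases "l = \<one>")
        case True
        then show ?thesis using R k by (auto simp: T1 tensor_space_def)
      next
        case False
        \<comment> \<open>So t is evaluated outside the only second label at which it is
          supported.\<close>
        then have "l \<otimes> inv r \<noteq> inv r" using r l by simp
        then show ?thesis using R k l False \<pi>0[OF k] by (simp add: tensor_coaction_Hquot[OF r s])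
      qed
    qed
  qed
qed

text \<open>The coaction translates the argument by f on the left, while invariance concerns right
  translation by k, and the two commute. The label condition only involves g r^-1 g^-1, which is
  unchanged under g \<mapsto> g k.\<close>

lemma left_subcomodule_E_space:
  assumes r: "r \<in> carrier G" and s: "vector_space s"
    and \<pi>: "group_representation (G\<lparr>carrier := centraliser G r\<rparr>) s \<pi>"
  shows "left_subcomodule (Dvee G) (fscale s) (tensor_space (carrier G \<times> carrier G))
    (coproduct_coaction (Dvee G) s) (E_space G r s \<pi>)"
proof -
  interpret vector_space s by fact
  have K: "centraliser G r \<subseteq> carrier G" using subgroup.subset[OF subgroup_centraliser[OF r]] .
  note E = mem_E_space_iff[OF r s \<pi>]
  have lin: "Vector_Spaces.linear s s (\<pi> k)" if "k \<in> centraliser G r" for k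
    using that \<pi> by (simp add: group_representation_def)
  have \<pi>add: "\<pi> k (v + w) = \<pi> k v + \<pi> k w" and \<pi>scale: "\<pi> k (s c v) = s c (\<pi> k v)" and \<pi>0: "\<pi> k 0 = 0"
    if "k \<in> centraliser G r" for k v w c
  proof -
    interpret Vector_Spaces.linear s s "\<pi> k" using that by (rule lin)
    show "\<pi> k (v + w) = \<pi> k v + \<pi> k w" "\<pi> k (s c v) = s c (\<pi> k v)" "\<pi> k 0 = 0"
      by (simp_all add: add scale zero)
  qed
  have "module.subspace (fscale s) (E_space G r s \<pi>)"
    unfolding subspace_iff[OF vector_space_fscale[OF s]]
    by (auto simp: E tensor_space_def fscale_apply \<pi>add \<pi>scale \<pi>0)
  moreover have "coproduct_coaction (Dvee G) s t a \<in> E_space G r s \<pi>" if t: "t \<in> E_space G r s \<pi>" for t a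
  proof -
    obtain f m where [simp]: "a = (f, m)" by (cases a)
    note L = coproduct_coaction_Dvee[OF s]
    have "\<pi> k (coproduct_coaction (Dvee G) s t a (g \<otimes> k, inv r)) = coproduct_coaction (Dvee G) s t a (g, inv r)"
      if g: "g \<in> carrier G" and k: "k \<in> centraliser G r" for g k
    proof -
      have kG: "k \<in> carrier G" "k \<otimes> r \<otimes> inv k = r" using k r by (simp_all add: mem_centraliser_iff)
      have "g \<otimes> k \<otimes> inv r \<otimes> inv (g \<otimes> k) = g \<otimes> inv (k \<otimes> r \<otimes> inv k) \<otimes> inv g"
        using g kG(1) r by (simp add: inv_mult_group m_assoc)
      then have conj: "g \<otimes> k \<otimes> inv r \<otimes> inv (g \<otimes> k) = g \<otimes> inv r \<otimes> inv g" using kG(2) by simp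
      have "\<pi> k (t (f \<otimes> (g \<otimes> k), inv r)) = t (f \<otimes> g, inv r)" if f: "f \<in> carrier G"
        using t f g k kG by (simp add: E m_assoc[symmetric])
      then show ?thesis using g kG(1) r \<pi>0[OF k] by (simp add: L conj)
    qed
    moreover have "coproduct_coaction (Dvee G) s t a (g, h) = 0" if "h \<noteq> inv r" for g h
      using t that by (simp add: E L)
    moreover have "coproduct_coaction (Dvee G) s t a \<in> tensor_space (carrier G \<times> carrier G)"
      by (auto simp: tensor_space_def L)
    ultimately show ?thesis by (simp add: E)
  qed
  ultimately show ?thesis
    unfolding left_subcomodule_def using left_comodule_coproduct[OF s] by (auto simp: E)
qed

end

section \<open>Sections over the inverse class with values in the translates of U\<close>

context crossed_module
begin

text \<open>Quantifying over all g avoids representatives of the points of the class. When the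
  centraliser preserves U, testing one g for each point gives the same condition.\<close>

definition conj_sections :: "'a \<Rightarrow> 'w set \<Rightarrow> ('a \<Rightarrow> 'w) set" where
  "conj_sections r U = {t \<in> tensor_space ((\<lambda>g. g \<otimes> inv r \<otimes> inv g) ` carrier G).
     \<forall>g\<in>carrier G. act (inv g) (t (g \<otimes> inv r \<otimes> inv g)) \<in> U}"

text \<open>The coaction at f reads t at the conjugate by f and applies f^-1. Hence the condition on
  the new section at g is the condition on t at f g.\<close>

lemma left_subcomodule_conj_sections:
  assumes r: "r \<in> carrier G" and U: "W.subspace U"
  shows "left_subcomodule (Dvee G) (fscale s) (tensor_space (carrier G)) (Delta_L G \<rho>)
    (conj_sections r U)"
proof -
  have sub: "conj_sections r U \<subseteq> tensor_space (carrier G)"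
  proof
    fix t assume t: "t \<in> conj_sections r U"
    have "y \<notin> (\<lambda>g. g \<otimes> inv r \<otimes> inv g) ` carrier G" if "y \<notin> carrier G" for y
      using that r by auto
    then show "t \<in> tensor_space (carrier G)" using t by (simp add: conj_sections_def tensor_space_def)
  qed
  moreover have "module.subspace (fscale s) (conj_sections r U)"
    unfolding subspace_iff[OF vector_space_fscale[OF W.vector_space_axioms]]
    using U by (auto simp: conj_sections_def tensor_space_def fscale_apply act.add act.scale act.zero
        W.subspace_def)
  moreover have "Delta_L G \<rho> t a \<in> conj_sections r U" if t: "t \<in> conj_sections r U" for t a
  proof -
    obtain f m where [simp]: "a = (f, m)" by (cases a)
    have conj: "f \<otimes> (g \<otimes> inv r \<otimes> inv g) \<otimes> inv f = (f \<otimes> g) \<otimes> inv r \<otimes> inv (f \<otimes> g)"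
      if "f \<in> carrier G" "g \<in> carrier G" for f g
      using that r by (simp add: inv_mult_group m_assoc)
    have "act (inv g) (Delta_L G \<rho> t a (g \<otimes> inv r \<otimes> inv g)) \<in> U" if g: "g \<in> carrier G" for g
    proof (cases "f \<in> carrier G \<and> m = g \<otimes> inv r \<otimes> inv g")
      case True
      then have "act (inv g) (Delta_L G \<rho> t a (g \<otimes> inv r \<otimes> inv g)) =
          act (inv (f \<otimes> g)) (t ((f \<otimes> g) \<otimes> inv r \<otimes> inv (f \<otimes> g)))"
        using g r conj[of f g] by (simp add: Delta_L_apply act_act inv_mult_group)
      then show ?thesis using t True g by (simp add: conj_sections_def)
    next
      case False
      then have "Delta_L G \<rho> t a (g \<otimes> inv r \<otimes> inv g) = 0" by (auto simp: Delta_L_apply)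
      then show ?thesis using U by (simp add: act.zero W.subspace_0)
    qed
    moreover have "Delta_L G \<rho> t a y = 0" if y: "y \<notin> (\<lambda>g. g \<otimes> inv r \<otimes> inv g) ` carrier G" for y
    proof (cases "f \<in> carrier G \<and> m \<in> carrier G \<and> y = m")
      case True
      have "f \<otimes> y \<otimes> inv f \<notin> (\<lambda>g. g \<otimes> inv r \<otimes> inv g) ` carrier G"
      proof
        assume "f \<otimes> y \<otimes> inv f \<in> (\<lambda>g. g \<otimes> inv r \<otimes> inv g) ` carrier G"
        then obtain g where g: "g \<in> carrier G" "f \<otimes> y \<otimes> inv f = g \<otimes> inv r \<otimes> inv g" by auto
        then have "y = inv f \<otimes> (g \<otimes> inv r \<otimes> inv g) \<otimes> f"
          using True r conj_inv_eq_iff[of f y "g \<otimes> inv r \<otimes> inv g"] by simp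
        also have "\<dots> = (inv f \<otimes> g) \<otimes> inv r \<otimes> inv (inv f \<otimes> g)"
          using True g r by (simp add: inv_mult_group m_assoc)
        finally show False using y True g by blast
      qed
      then show ?thesis using True t
        by (simp add: Delta_L_apply conj_sections_def tensor_space_def act.zero)
    qed (auto simp: Delta_L_apply)
    ultimately show ?thesis by (auto simp: conj_sections_def tensor_space_def)
  qed
  ultimately show ?thesis
    unfolding left_subcomodule_def using left_comodule_Delta_L by blast
qed

text \<open>The map is defined through chosen representatives. Invariance in E together with
  equivariance of \<open>\<iota>\<close> removes the dependence on the choice, and all further
  checks use an arbitrary representative g.\<close>

lemma ex_intertwining_iso_conj_sections:
  assumes r: "r \<in> carrier G"
    and \<pi>: "group_representation (G\<lparr>carrier := centraliser G r\<rparr>) sV \<pi>"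
    and \<iota>: "Vector_Spaces.linear sV s \<iota>" "inj \<iota>"
    and equiv: "\<And>k v. k \<in> centraliser G r \<Longrightarrow> \<iota> (\<pi> k v) = act k (\<iota> v)"
  shows "\<exists>\<phi>. intertwining_iso (fscale sV) (E_space G r sV \<pi>) (coproduct_coaction (Dvee G) sV)
    (fscale s) (conj_sections r (range \<iota>)) (Delta_L G \<rho>) \<phi>"
proof -
  interpret \<iota>: Vector_Spaces.linear sV s \<iota> by fact
  have sV: "vector_space sV" by (rule \<iota>.vs1.vector_space_axioms)
  note E = mem_E_space_iff[OF r sV \<pi>]
  let ?c = "\<lambda>g. g \<otimes> inv r \<otimes> inv g"
  \<comment> \<open>Some g with y = g r^-1 g^-1; its value is used only for y in the inverse
    class.\<close>
  define \<gamma> where "\<gamma> y = (SOME g. g \<in> carrier G \<and> y = ?c g)" for y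
  define \<phi> where "\<phi> t y = (if y \<in> ?c ` carrier G then act (\<gamma> y) (\<iota> (t (\<gamma> y, inv r))) else 0)" for t y
  have \<phi>: "\<phi> t (?c g) = act g (\<iota> (t (g, inv r)))" if t: "t \<in> E_space G r sV \<pi>" and g: "g \<in> carrier G" for t g
  proof -
    define g' where "g' = \<gamma> (?c g)"
    have g': "g' \<in> carrier G" "?c g = ?c g'"
      unfolding g'_def \<gamma>_def using someI[of "\<lambda>g'. g' \<in> carrier G \<and> ?c g = ?c g'" g] g by auto
    \<comment> \<open>Two elements conjugating r^-1 to the same point differ on the right by an
      element of the centraliser.\<close>
    define k where "k = inv g \<otimes> g'"
    have k: "k \<in> carrier G" "g' = g \<otimes> k" using g g' by (auto simp: k_def m_assoc[symmetric])
    have "inv (?c h) = h \<otimes> r \<otimes> inv h" if "h \<in> carrier G" for h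
      using that r by (simp add: inv_mult_group m_assoc)
    then have "g \<otimes> r \<otimes> inv g = g' \<otimes> r \<otimes> inv g'" using g g' by metis
    then have "inv g \<otimes> (g' \<otimes> r \<otimes> inv g') \<otimes> g = r"
      using conj_inv_eq_iff[OF g r, of "g' \<otimes> r \<otimes> inv g'"] g' r by simp
    then have "k \<otimes> r \<otimes> inv k = r" using g g' r by (simp add: k_def inv_mult_group m_assoc)
    then have kK: "k \<in> centraliser G r" using k r by (simp add: mem_centraliser_iff)
    have "\<phi> t (?c g) = act g' (\<iota> (t (g', inv r)))" using g by (simp add: \<phi>_def g'_def)
    also have "\<dots> = act g (\<iota> (\<pi> k (t (g \<otimes> k, inv r))))"
      using g k by (simp add: equiv[OF kK] act_act)
    also have "\<dots> = act g (\<iota> (t (g, inv r)))" using t g kK by (simp add: E)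
    finally show ?thesis .
  qed
  have \<phi>0: "\<phi> t y = 0" if "y \<notin> ?c ` carrier G" for t y using that by (simp add: \<phi>_def)
  have "linear_on (fscale sV) (E_space G r sV \<pi>) (fscale s) (conj_sections r (range \<iota>)) \<phi>"
    unfolding linear_on_def
    by (auto simp: conj_sections_def tensor_space_def \<phi> \<phi>0)
      (auto simp: \<phi>_def fun_eq_iff fscale_apply \<iota>.add \<iota>.scale act.add act.scale)
  moreover have "bij_betw \<phi> (E_space G r sV \<pi>) (conj_sections r (range \<iota>))"
  proof (rule bij_betw_imageI)
    show "inj_on \<phi> (E_space G r sV \<pi>)"
    proof
      fix t t' assume t: "t \<in> E_space G r sV \<pi>" "t' \<in> E_space G r sV \<pi>" and eq: "\<phi> t = \<phi> t'"
      have "t (g, h) = t' (g, h)" for g h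
      proof (cases "g \<in> carrier G \<and> h = inv r")
        case True
        then have "act g (\<iota> (t (g, inv r))) = act g (\<iota> (t' (g, inv r)))"
          using \<phi>[OF t(1), of g] \<phi>[OF t(2), of g] eq by simp
        then have "\<iota> (t (g, inv r)) = \<iota> (t' (g, inv r))" using True by (metis act_inv(1))
        then show ?thesis using True \<iota>(2) by (simp add: inj_eq)
      next
        case False
        then show ?thesis using t by (auto simp: E tensor_space_def)
      qed
      then show "t = t'" by auto
    qed
    show "\<phi> ` E_space G r sV \<pi> = conj_sections r (range \<iota>)"
    proof (intro equalityI subsetI)
      fix u assume "u \<in> \<phi> ` E_space G r sV \<pi>"
      then show "u \<in> conj_sections r (range \<iota>)"
        by (auto simp: conj_sections_def tensor_space_def \<phi> \<phi>0)
    next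
      fix u assume u: "u \<in> conj_sections r (range \<iota>)"
      \<comment> \<open>The preimage undoes first g and then \<open>\<iota>\<close>; the values
        concerned lie in \<open>range \<iota>\<close> by the definition of the sections, so
        \<open>the_inv\<close> is a genuine inverse on them.\<close>
      define t where "t = (\<lambda>(g, h). if g \<in> carrier G \<and> h = inv r
        then the_inv \<iota> (act (inv g) (u (?c g))) else 0)"
      have \<iota>t: "\<iota> (t (g, inv r)) = act (inv g) (u (?c g))" if "g \<in> carrier G" for g
        using u that \<iota>(2) by (auto simp: t_def conj_sections_def intro: f_the_inv_into_f)
      have "t \<in> E_space G r sV \<pi>" unfolding E
      proof (intro conjI ballI)
        fix g k assume g: "g \<in> carrier G" and k: "k \<in> centraliser G r"
        have kG: "k \<in> carrier G" "k \<otimes> r \<otimes> inv k = r" using k r by (simp_all add: mem_centraliser_iff)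
        have "?c (g \<otimes> k) = g \<otimes> inv (k \<otimes> r \<otimes> inv k) \<otimes> inv g"
          using g kG(1) r by (simp add: inv_mult_group m_assoc)
        then have "?c (g \<otimes> k) = ?c g" using kG(2) by simp
        then have "\<iota> (\<pi> k (t (g \<otimes> k, inv r))) = act k (act (inv (g \<otimes> k)) (u (?c g)))"
          using g kG by (simp add: equiv[OF k] \<iota>t)
        also have "\<dots> = \<iota> (t (g, inv r))"
          using g kG by (simp add: \<iota>t act_act inv_mult_group m_assoc[symmetric])
        finally show "\<pi> k (t (g \<otimes> k, inv r)) = t (g, inv r)" using \<iota>(2) by (simp add: inj_eq)
      qed (use r in \<open>auto simp: t_def tensor_space_def\<close>)
      moreover have "\<phi> t = u"
      proof
        fix y
        show "\<phi> t y = u y"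
        proof (cases "y \<in> ?c ` carrier G")
          case True
          then obtain g where g: "g \<in> carrier G" "y = ?c g" by auto
          then show ?thesis using \<phi>[OF \<open>t \<in> E_space G r sV \<pi>\<close> g(1)] by (simp add: \<iota>t)
        next
          case False
          then show ?thesis using u by (simp add: \<phi>0 conj_sections_def tensor_space_def)
        qed
      qed
      ultimately show "u \<in> \<phi> ` E_space G r sV \<pi>" by blast
    qed
  qed
  moreover have "Delta_L G \<rho> (\<phi> t) a = \<phi> (coproduct_coaction (Dvee G) sV t a)"
    if t: "t \<in> E_space G r sV \<pi>" for t a
  proof
    fix y
    obtain f m where [simp]: "a = (f, m)" by (cases a)
    have Lt: "coproduct_coaction (Dvee G) sV t a \<in> E_space G r sV \<pi>"
      using left_subcomodule_E_space[OF r sV \<pi>] t by (simp add: left_subcomodule_def)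
    have "W.subspace (range \<iota>)"
      using \<iota>.subspace_image[OF \<iota>.vs1.subspace_UNIV] .
    moreover have "\<phi> t \<in> conj_sections r (range \<iota>)"
      using t by (auto simp: conj_sections_def tensor_space_def \<phi> \<phi>0)
    \<comment> \<open>This settles the points off the inverse class, where a section
      vanishes.\<close>
    ultimately have sec: "Delta_L G \<rho> (\<phi> t) a \<in> conj_sections r (range \<iota>)"
      using left_subcomodule_conj_sections[OF r] by (simp add: left_subcomodule_def)
    show "Delta_L G \<rho> (\<phi> t) a y = \<phi> (coproduct_coaction (Dvee G) sV t a) y"
    proof (cases "y \<in> ?c ` carrier G")
      case False
      then show ?thesis using sec by (simp add: \<phi>0 conj_sections_def tensor_space_def)
    next
      case True
      then obtain u where u: "u \<in> carrier G" "y = ?c u" by auto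
      have conj: "f \<otimes> ?c u \<otimes> inv f = ?c (f \<otimes> u)" if "f \<in> carrier G"
        using that u r by (simp add: inv_mult_group m_assoc)
      have "act (inv f) (act (f \<otimes> u) v) = act u v" if "f \<in> carrier G" for v
        using that u by (simp add: act_act m_assoc[symmetric])
      then have "Delta_L G \<rho> (\<phi> t) a y =
          (if f \<in> carrier G \<and> m = ?c u then act u (\<iota> (t (f \<otimes> u, inv r))) else 0)"
        using u r t by (auto simp: Delta_L_apply conj \<phi>)
      also have "\<dots> = \<phi> (coproduct_coaction (Dvee G) sV t a) y"
        using u r \<phi>[OF Lt u(1)] by (simp add: coproduct_coaction_Dvee[OF sV] \<iota>.zero act.zero)
      finally show ?thesis .
    qed
  qed
  ultimately show ?thesis unfolding intertwining_iso_def by blast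
qed

text \<open>Over c the operator is conjugated by q c, so t is fixed there exactly when (q c)^-1
  takes t c into the fixed space U. Invariance of U replaces q c by any g conjugating r to c, and
  \<open>inv_Fourier\<close> relabels c as c^-1.\<close>

lemma F_ker_space_eq_conj_sections:
  assumes r: "r \<in> carrier G" and C: "C = (\<lambda>g. g \<otimes> r \<otimes> inv g) ` carrier G"
    and q: "\<And>c. c \<in> C \<Longrightarrow> q c \<in> carrier G" "\<And>c. c \<in> C \<Longrightarrow> q c \<otimes> r \<otimes> inv (q c) = c"
    and P: "\<And>n. n \<notin> centraliser G r \<Longrightarrow> P n = 0"
    and U: "\<And>w. w \<in> U \<longleftrightarrow> (\<Sum>n\<in>centraliser G r. s (P n) (act n (part r w))) = w"
    and K_inv: "\<And>k w. k \<in> centraliser G r \<Longrightarrow> w \<in> U \<Longrightarrow> act k w \<in> U"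
  shows "F_ker_space G C q (\<lambda>(g, n). ket r g * P n) s \<rho> = conj_sections r U"
proof -
  let ?X = "\<lambda>(g, n). ket r g * P n"
  have CG: "C \<subseteq> carrier G" using C r by auto
  then have finC: "finite C" using finite_carrier by (rule finite_subset)
  have inv_C: "inv (g \<otimes> r \<otimes> inv g) = g \<otimes> inv r \<otimes> inv g" if "g \<in> carrier G" for g
    using that r by (simp add: inv_mult_group m_assoc)
  have P_cov: "P_cov G C q ?X s \<rho> t c =
      act (q c) (\<Sum>n\<in>centraliser G r. s (P n) (act n (part r (act (inv (q c)) (t c)))))"
    if "c \<in> C" for t c
  proof -
    have "P_cov G C q ?X s \<rho> t c = (\<Sum>c'\<in>C. if c' = c then double_act G s \<rho>
        (double_mult G (double_mult G (double_of_group G (q c)) ?X) (double_of_group G (inv (q c)))) (t c)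
        else 0)"
      unfolding P_cov_def sum_fun_apply by (intro sum.cong) (auto simp: tens_apply)
    then show ?thesis
      using that finC by (simp add: sum.delta double_act_conjugate[OF r q(1)[OF that] P])
  qed
  have P_cov0: "P_cov G C q ?X s \<rho> t c = 0" if "c \<notin> C" for t c
    unfolding P_cov_def sum_fun_apply using that by (intro sum.neutral) (auto simp: tens_apply)
  have eq_act_iff: "w = act g v \<longleftrightarrow> v = act (inv g) w" if "g \<in> carrier G" for g v w
    using that by auto
  have "t - P_cov G C q ?X s \<rho> t = 0 \<longleftrightarrow> (\<forall>c\<in>C. act (inv (q c)) (t c) \<in> U)"
    if "t \<in> tensor_space C" for t
  proof -
    have "t - P_cov G C q ?X s \<rho> t = 0 \<longleftrightarrow> (\<forall>c\<in>C. t c = P_cov G C q ?X s \<rho> t c)"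
      using that P_cov0 by (auto simp: fun_eq_iff tensor_space_def)
    also have "\<dots> \<longleftrightarrow> (\<forall>c\<in>C. act (inv (q c)) (t c) \<in> U)"
    proof (rule ball_cong[OF refl])
      fix c assume c: "c \<in> C"
      show "t c = P_cov G C q ?X s \<rho> t c \<longleftrightarrow> act (inv (q c)) (t c) \<in> U"
        unfolding P_cov[OF c] U by (rule eq_act_iff[OF q(1)[OF c]])
    qed
    finally show ?thesis .
  qed
  then have ker: "ker_P_cov G C q ?X s \<rho> = {t \<in> tensor_space C. \<forall>c\<in>C. act (inv (q c)) (t c) \<in> U}"
    unfolding ker_P_cov_def by auto
  also have "\<dots> = {t \<in> tensor_space C. \<forall>g\<in>carrier G. act (inv g) (t (g \<otimes> r \<otimes> inv g)) \<in> U}"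
  proof -
    have "act (inv g) (t (g \<otimes> r \<otimes> inv g)) \<in> U"
      if t: "\<forall>c\<in>C. act (inv (q c)) (t c) \<in> U" and g: "g \<in> carrier G" for t g
    proof -
      define c where "c = g \<otimes> r \<otimes> inv g"
      have c: "c \<in> C" using g C by (auto simp: c_def)
      note qc = q[OF c]
      \<comment> \<open>Since g and q c conjugate r to the same c, the element g^-1 (q c)
        centralises r.\<close>
      have "inv g \<otimes> (q c \<otimes> r \<otimes> inv (q c)) \<otimes> g = r"
        using conj_inv_eq_iff[OF g r, of c] qc(2) c CG by (auto simp: c_def)
      then have "(inv g \<otimes> q c) \<otimes> r \<otimes> inv (inv g \<otimes> q c) = r"
        using g qc(1) r by (simp add: inv_mult_group m_assoc)
      then have "inv g \<otimes> q c \<in> centraliser G r" using g qc(1) r by (simp add: mem_centraliser_iff)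
      then have "act (inv g \<otimes> q c) (act (inv (q c)) (t c)) \<in> U" by (rule K_inv) (use t c in blast)
      then show ?thesis using g qc(1) unfolding c_def[symmetric] by (simp add: act_act m_assoc)
    qed
    moreover have "act (inv (q c)) (t c) \<in> U"
      if t: "\<forall>g\<in>carrier G. act (inv g) (t (g \<otimes> r \<otimes> inv g)) \<in> U" and c: "c \<in> C" for t c
      using t q[OF c] by force
    ultimately show ?thesis by blast
  qed
  finally have ker: "ker_P_cov G C q ?X s \<rho> =
    {t \<in> tensor_space C. \<forall>g\<in>carrier G. act (inv g) (t (g \<otimes> r \<otimes> inv g)) \<in> U}" .
  have F: "inv_Fourier G C t y = (if inv y \<in> C then t (inv y) else 0)" if "y \<in> carrier G" for t y
  proof -
    have "inv_Fourier G C t y = (\<Sum>c\<in>C. if c = inv y then t c else 0)"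
      unfolding inv_Fourier_def sum_fun_apply
      using that CG by (intro sum.cong) (auto simp: tens_apply)
    then show ?thesis using finC by (simp add: sum.delta)
  qed
  have F0: "inv_Fourier G C t y = 0" if "y \<notin> carrier G" for t y
    unfolding inv_Fourier_def sum_fun_apply
    using that CG by (intro sum.neutral) (auto simp: tens_apply)
  have mem: "inv y \<in> C \<longleftrightarrow> y \<in> (\<lambda>g. g \<otimes> inv r \<otimes> inv g) ` carrier G" if y: "y \<in> carrier G" for y
  proof -
    have "inv y = g \<otimes> r \<otimes> inv g \<longleftrightarrow> y = g \<otimes> inv r \<otimes> inv g" if "g \<in> carrier G" for g
      using inv_C[OF that] y r that by (metis inv_inv m_closed inv_closed)
    then show ?thesis unfolding C by auto
  qed
  show ?thesis unfolding F_ker_space_def ker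
  proof (intro equalityI subsetI)
    fix u assume "u \<in> inv_Fourier G C `
      {t \<in> tensor_space C. \<forall>g\<in>carrier G. act (inv g) (t (g \<otimes> r \<otimes> inv g)) \<in> U}"
    then obtain t where t: "t \<in> tensor_space C" "u = inv_Fourier G C t"
      "\<And>g. g \<in> carrier G \<Longrightarrow> act (inv g) (t (g \<otimes> r \<otimes> inv g)) \<in> U" by auto
    have "u (g \<otimes> inv r \<otimes> inv g) = t (g \<otimes> r \<otimes> inv g)" if g: "g \<in> carrier G" for g
    proof -
      have "inv (g \<otimes> inv r \<otimes> inv g) = g \<otimes> r \<otimes> inv g" using g r inv_C[OF g] by (metis inv_inv m_closed inv_closed)
      moreover have "g \<otimes> r \<otimes> inv g \<in> C" using g by (simp add: C)
      ultimately show ?thesis using g r by (simp add: t(2) F)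
    qed
    moreover have "u y = 0" if "y \<notin> (\<lambda>g. g \<otimes> inv r \<otimes> inv g) ` carrier G" for y
      using that mem[of y] by (cases "y \<in> carrier G") (auto simp: t(2) F F0)
    ultimately show "u \<in> conj_sections r U" using t(3) by (simp add: conj_sections_def tensor_space_def)
  next
    fix u assume u: "u \<in> conj_sections r U"
    \<comment> \<open>The preimage relabels u along inversion, a bijection between C and the inverse
      class.\<close>
    define t where "t c = (if c \<in> C then u (inv c) else 0)" for c
    have "t (g \<otimes> r \<otimes> inv g) = u (g \<otimes> inv r \<otimes> inv g)" if "g \<in> carrier G" for g
      using that C by (auto simp: t_def inv_C)
    then have "t \<in> {t \<in> tensor_space C. \<forall>g\<in>carrier G. act (inv g) (t (g \<otimes> r \<otimes> inv g)) \<in> U}"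
      using u by (auto simp: conj_sections_def tensor_space_def t_def)
    moreover have "inv_Fourier G C t y = u y" for y
    proof (cases "y \<in> carrier G")
      case True
      then show ?thesis
        using u mem[OF True] by (auto simp: F t_def conj_sections_def tensor_space_def)
    next
      case False
      then have "y \<notin> (\<lambda>g. g \<otimes> inv r \<otimes> inv g) ` carrier G" using r by auto
      then show ?thesis using u False by (simp add: F0 conj_sections_def tensor_space_def)
    qed
    then have "u = inv_Fourier G C t" by auto
    ultimately show "u \<in> inv_Fourier G C `
      {t \<in> tensor_space C. \<forall>g\<in>carrier G. act (inv g) (t (g \<otimes> r \<otimes> inv g)) \<in> U}"
      by (intro image_eqI)
  qed
qed

section \<open>Copies of V in the pushout of W\<close>

lemma pushout_Hproj:
  "pushout (Dvee G) s (Hproj G r) \<rho> w (g, h) = (if g \<in> centraliser G r then \<rho> w (g, h) else 0)"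
proof -
  have "pushout (Dvee G) s (Hproj G r) \<rho> w (g, h) =
      (\<Sum>x\<in>carrier G \<times> carrier G. if x = (g, h) then (if g \<in> centraliser G r then \<rho> w x else 0) else 0)"
    unfolding pushout_def bbasis_Dvee
    by (intro sum.cong refl) (auto simp: quotient_map_def tens_apply split: if_splits)
  then show ?thesis using finite_carrier rho_outside[of "(g, h)"] by (auto simp: sum.delta)
qed

text \<open>Components of the coaction at the identity give the degree, and summing the components
  at k over all degrees gives the action of k. Thus a copy of V is the image of an injective
  centraliser map into the degree r part.\<close>

lemma intertwining_iso_V_coaction_iff:
  assumes r: "r \<in> carrier G" and lin: "Vector_Spaces.linear sV s \<iota>"
    and \<pi>: "group_representation (G\<lparr>carrier := centraliser G r\<rparr>) sV \<pi>"
  shows "intertwining_iso sV UNIV (V_coaction G r \<pi>) s U (pushout (Dvee G) s (Hproj G r) \<rho>) \<iota> \<longleftrightarrow>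
    inj \<iota> \<and> range \<iota> = U \<and> (\<forall>v. part r (\<iota> v) = \<iota> v) \<and>
    (\<forall>k\<in>centraliser G r. \<forall>v. \<iota> (\<pi> k v) = act k (\<iota> v))"
proof -
  interpret \<iota>: Vector_Spaces.linear sV s \<iota> by fact
  have K: "subgroup (centraliser G r) G" by (rule subgroup_centraliser[OF r])
  have one: "\<one> \<in> centraliser G r" by (rule subgroup.one_closed[OF K])
  have \<pi>one: "\<pi> \<one> v = v" for v using \<pi> by (simp add: group_representation_def)
  have rho_iff: "(\<forall>v a. pushout (Dvee G) s (Hproj G r) \<rho> (\<iota> v) a = \<iota> (V_coaction G r \<pi> v a)) \<longleftrightarrow>
      (\<forall>v. part r (\<iota> v) = \<iota> v) \<and> (\<forall>k\<in>centraliser G r. \<forall>v. \<iota> (\<pi> k v) = act k (\<iota> v))"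
    (is "?L \<longleftrightarrow> ?R")
  proof
    assume ?L
    then have *: "\<rho> (\<iota> v) (k, h) = (if h = r then \<iota> (\<pi> k v) else 0)" if "k \<in> centraliser G r" for v k h
      using that \<open>?L\<close>[rule_format, of v "(k, h)"]
      by (simp add: pushout_Hproj V_coaction_apply[OF r] \<iota>.zero split: if_splits)
    then have "part r (\<iota> v) = \<iota> v" for v using one \<pi>one by (simp add: cm_part_def)
    moreover have "act k (\<iota> v) = \<iota> (\<pi> k v)" if "k \<in> centraliser G r" for k v
      using *[OF that] finite_carrier r by (simp add: cm_act_def sum.delta)
    ultimately show ?R by auto
  next
    assume R: ?R
    have "\<rho> (\<iota> v) (k, h) = (if h = r then \<iota> (\<pi> k v) else 0)" if k: "k \<in> centraliser G r" for v k h
    proof (cases "h \<in> carrier G")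
      case True
      \<comment> \<open>Orthogonality of the grading projections: a vector equal to its degree r
        part has no other part.\<close>
      have "part h (\<iota> v) = (if h = r then \<iota> v else 0)"
        using R part_part[OF r True, of "\<iota> v"] by auto
      then show ?thesis using rho_eq[OF subgroup.mem_carrier[OF K k] True] R k by (auto simp: act.zero)
    next
      case False
      then show ?thesis using r rho_outside[of "(k, h)"] by auto
    qed
    then show ?L by (auto simp: pushout_Hproj V_coaction_apply[OF r] \<iota>.zero)
  qed
  show ?thesis
    unfolding intertwining_iso_def rho_iff[unfolded all_simps, symmetric]
    by (auto simp: linear_on_def \<iota>.add \<iota>.scale bij_betw_def)
qed

lemma right_subcomodule_pushout_range:
  assumes r: "r \<in> carrier G" and lin: "Vector_Spaces.linear sV s \<iota>"
    and \<pi>: "group_representation (G\<lparr>carrier := centraliser G r\<rparr>) sV \<pi>"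
    and comod: "right_comodule (Hquot G r) s UNIV (pushout (Dvee G) s (Hproj G r) \<rho>)"
    and iso: "intertwining_iso sV UNIV (V_coaction G r \<pi>) s U (pushout (Dvee G) s (Hproj G r) \<rho>) \<iota>"
  shows "right_subcomodule (Hquot G r) s UNIV (pushout (Dvee G) s (Hproj G r) \<rho>) U"
proof -
  interpret \<iota>: Vector_Spaces.linear sV s \<iota> by fact
  have U: "U = range \<iota>"
    using iso unfolding intertwining_iso_V_coaction_iff[OF r lin \<pi>] by simp
  have "W.subspace U" unfolding U by (rule \<iota>.subspace_image[OF \<iota>.vs1.subspace_UNIV])
  moreover have "pushout (Dvee G) s (Hproj G r) \<rho> u a \<in> U" if "u \<in> U" for u a
    using iso that unfolding U intertwining_iso_def by (cases a) auto
  ultimately show ?thesis using comod by (simp add: right_subcomodule_def)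
qed

text \<open>The kernel is an invariant subspace, so by irreducibility the map is injective or zero.
  If it is injective, its range is a copy of V and uniqueness identifies it with U.\<close>

lemma range_subset_unique_copy:
  assumes r: "r \<in> carrier G"
    and irr: "irreducible_representation (G\<lparr>carrier := centraliser G r\<rparr>) sV \<pi>"
    and unique: "\<And>U'. right_subcomodule (Hquot G r) s UNIV (pushout (Dvee G) s (Hproj G r) \<rho>) U' \<Longrightarrow>
      right_comodules_isomorphic (Hquot G r) sV UNIV (V_coaction G r \<pi>)
        s U' (pushout (Dvee G) s (Hproj G r) \<rho>) \<Longrightarrow> U' = U"
    and V: "right_comodule (Hquot G r) sV UNIV (V_coaction G r \<pi>)"
    and W: "right_comodule (Hquot G r) s UNIV (pushout (Dvee G) s (Hproj G r) \<rho>)"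
    and U: "W.subspace U"
    and lin: "Vector_Spaces.linear sV s \<iota>"
    and deg: "\<And>v. part r (\<iota> v) = \<iota> v"
    and equiv: "\<And>k v. k \<in> centraliser G r \<Longrightarrow> \<iota> (\<pi> k v) = act k (\<iota> v)"
  shows "range \<iota> \<subseteq> U"
proof -
  interpret \<iota>: Vector_Spaces.linear sV s \<iota> by fact
  have \<pi>: "group_representation (G\<lparr>carrier := centraliser G r\<rparr>) sV \<pi>"
    using irr by (simp add: irreducible_representation_def)
  let ?N = "{v. \<iota> v = 0}"
  have "\<iota>.vs1.subspace ?N" by (rule \<iota>.subspace_kernel)
  moreover have "\<pi> k ` ?N \<subseteq> ?N" if "k \<in> centraliser G r" for k
    using that by (auto simp: equiv act.zero)
  ultimately have "?N = {0} \<or> ?N = UNIV"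
    using irr unfolding irreducible_representation_def by simp
  then show ?thesis
  proof
    assume "?N = {0}"
    then have "inj \<iota>" using \<iota>.inj_iff_eq_0 by blast
    then have iso: "intertwining_iso sV UNIV (V_coaction G r \<pi>) s (range \<iota>)
        (pushout (Dvee G) s (Hproj G r) \<rho>) \<iota>"
      unfolding intertwining_iso_V_coaction_iff[OF r lin \<pi>] using deg equiv by simp
    have sub: "right_subcomodule (Hquot G r) s UNIV (pushout (Dvee G) s (Hproj G r) \<rho>) (range \<iota>)"
      by (rule right_subcomodule_pushout_range[OF r lin \<pi> W iso])
    have "range \<iota> = U"
      using unique[OF sub] V iso right_comodule_if_right_subcomodule[OF sub]
      unfolding right_comodules_isomorphic_def by blast
    then show ?thesis by simp
  next
    assume "?N = UNIV"
    then have "\<iota> v = 0" for v by blast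
    then show ?thesis using W.subspace_0[OF U] by auto
  qed
qed

end

section \<open>Change of base point in the class, and the final assembly\<close>

text \<open>The class is given as the orbit of some x. Writing r = a x a^-1, right multiplication of
  g by a or a^-1 moves the base point between x and r.\<close>

lemma (in group) conjugacy_class_eq:
  assumes "C \<in> conjugacy_classes G" and "r \<in> C"
  shows "r \<in> carrier G" and "C = (\<lambda>g. g \<otimes> r \<otimes> inv g) ` carrier G"
proof -
  obtain x where x: "x \<in> carrier G" and "C = {g \<otimes> x \<otimes> inv g |g. g \<in> carrier G}"
    using assms(1) by (auto simp: conjugacy_classes_def orbits_def orbit_def conj_action_def)
  then have C: "C = (\<lambda>g. g \<otimes> x \<otimes> inv g) ` carrier G" by auto
  obtain a where a: "a \<in> carrier G" "r = a \<otimes> x \<otimes> inv a" using assms(2) C by auto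
  show r: "r \<in> carrier G" using a x by simp
  have "g \<otimes> x \<otimes> inv g = (g \<otimes> inv a) \<otimes> r \<otimes> inv (g \<otimes> inv a)" if "g \<in> carrier G" for g
    using that a(1) x by (simp add: a(2) inv_mult_group m_assoc inv_solve_left')
      (simp add: m_assoc[symmetric])
  then have "g \<otimes> x \<otimes> inv g \<in> (\<lambda>g. g \<otimes> r \<otimes> inv g) ` carrier G" if "g \<in> carrier G" for g
    using that a(1) by (intro image_eqI[where x = "g \<otimes> inv a"]) simp_all
  moreover have "g \<otimes> r \<otimes> inv g = (g \<otimes> a) \<otimes> x \<otimes> inv (g \<otimes> a)" if "g \<in> carrier G" for g
    using that a(1) x by (simp add: a(2) inv_mult_group m_assoc)
  then have "g \<otimes> r \<otimes> inv g \<in> (\<lambda>g. g \<otimes> x \<otimes> inv g) ` carrier G" if "g \<in> carrier G" for g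
    using that a(1) by (intro image_eqI[where x = "g \<otimes> a"]) simp_all
  ultimately show "C = (\<lambda>g. g \<otimes> r \<otimes> inv g) ` carrier G"
    unfolding C by (intro equalityI image_subsetI)
qed

text \<open>Containment of V is read as containment of exactly one copy. With higher multiplicity
  the projection would fix the whole isotypic part of degree r, and the right hand side would be
  larger than E.\<close>

theorem corollary3p7:
  fixes G :: "('g, 'z) monoid_scheme"
    and C :: "'g set" and r :: 'g
    and \<pi> :: "'g \<Rightarrow> 'v::ab_group_add \<Rightarrow> 'v" and sV :: "complex \<Rightarrow> 'v \<Rightarrow> 'v" and BV :: "'v set"
    and sW :: "complex \<Rightarrow> 'w::ab_group_add \<Rightarrow> 'w" and \<rho> :: "'w \<Rightarrow> 'g \<times> 'g \<Rightarrow> 'w"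
    and q :: "'g \<Rightarrow> 'g"
  assumes "group G" and "finite (carrier G)"
    and "C \<in> conjugacy_classes G" and "r \<in> C"
    and "\<And>c. c \<in> C \<Longrightarrow> q c \<in> carrier G"
    and "\<And>c. c \<in> C \<Longrightarrow> q c \<otimes>\<^bsub>G\<^esub> r \<otimes>\<^bsub>G\<^esub> inv\<^bsub>G\<^esub> (q c) = c"
    and "q r = \<one>\<^bsub>G\<^esub>"
    and "finite_dimensional_vector_space sV BV"
    and "irreducible_representation (G\<lparr>carrier := centraliser G r\<rparr>) sV \<pi>"
    and "right_comodule (Dvee G) sW UNIV \<rho>"
    and contains_once:
      "\<exists>!U. right_subcomodule (Hquot G r) sW UNIV (pushout (Dvee G) sW (Hproj G r) \<rho>) U \<and>
            right_comodules_isomorphic (Hquot G r) sV UNIV (V_coaction G r \<pi>)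
              sW U (pushout (Dvee G) sW (Hproj G r) \<rho>)"
  shows
    "left_subcomodule (Dvee G) (fscale sV) (tensor_space (carrier G \<times> carrier G))
       (coproduct_coaction (Dvee G) sV) (E_space G r sV \<pi>) \<and>
     left_subcomodule (Dvee G) (fscale sW) (tensor_space (carrier G)) (Delta_L G \<rho>)
       (F_ker_space G C q (P_r_pi G r sV BV \<pi>) sW \<rho>) \<and>
     left_comodules_isomorphic (Dvee G)
       (fscale sV) (E_space G r sV \<pi>) (coproduct_coaction (Dvee G) sV)
       (fscale sW) (F_ker_space G C q (P_r_pi G r sV BV \<pi>) sW \<rho>) (Delta_L G \<rho>)"
proof -
  interpret finite_group G
    using \<open>group G\<close> \<open>finite (carrier G)\<close> by (simp add: finite_group_def finite_group_axioms_def)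
  interpret crossed_module G sW \<rho>
    by unfold_locales fact
  interpret V: finite_dimensional_vector_space sV BV by fact
  note r = conjugacy_class_eq(1)[OF \<open>C \<in> conjugacy_classes G\<close> \<open>r \<in> C\<close>]
  note C = conjugacy_class_eq(2)[OF \<open>C \<in> conjugacy_classes G\<close> \<open>r \<in> C\<close>]
  let ?K = "centraliser G r" and ?\<sigma> = "pushout (Dvee G) sW (Hproj G r) \<rho>"
  let ?GK = "G\<lparr>carrier := ?K\<rparr>"
  note irr = \<open>irreducible_representation ?GK sV \<pi>\<close>
  have \<pi>: "group_representation ?GK sV \<pi>"
    using irr by (simp add: irreducible_representation_def)
  have K: "subgroup ?K G" by (rule subgroup_centraliser[OF r])
  have groupK: "group ?GK" by (rule subgroup.subgroup_is_group[OF K is_group])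
  have finK: "finite ?K" using subgroup.subset[OF K] finite_carrier by (rule finite_subset)
  have act_rep: "group_representation ?GK sW act" by (rule group_representation_act[OF K])
  have invK: "inv\<^bsub>?GK\<^esub> n = inv\<^bsub>G\<^esub> n" if "n \<in> ?K" for n
    using m_inv_consistent[OF K that] by simp
  obtain U where sub: "right_subcomodule (Hquot G r) sW UNIV ?\<sigma> U"
    and iso: "right_comodules_isomorphic (Hquot G r) sV UNIV (V_coaction G r \<pi>) sW U ?\<sigma>"
    and unique: "\<And>U'. right_subcomodule (Hquot G r) sW UNIV ?\<sigma> U' \<Longrightarrow>
      right_comodules_isomorphic (Hquot G r) sV UNIV (V_coaction G r \<pi>) sW U' ?\<sigma> \<Longrightarrow> U' = U"
    using contains_once by (elim ex1E) blast
  have U: "W.subspace U" using sub by (simp add: right_subcomodule_def)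
  obtain \<iota> where \<iota>_iso: "intertwining_iso sV UNIV (V_coaction G r \<pi>) sW U ?\<sigma> \<iota>"
    using iso unfolding right_comodules_isomorphic_def by blast
  then have \<iota>_lin: "Vector_Spaces.linear sV sW \<iota>"
    by unfold_locales (auto simp: intertwining_iso_def linear_on_def)
  interpret \<iota>: Vector_Spaces.linear sV sW \<iota> by fact
  have \<iota>: "inj \<iota>" "range \<iota> = U" "\<And>v. part r (\<iota> v) = \<iota> v"
    "\<And>k v. k \<in> ?K \<Longrightarrow> \<iota> (\<pi> k v) = act k (\<iota> v)"
    using \<iota>_iso unfolding intertwining_iso_V_coaction_iff[OF r \<iota>_lin \<pi>] by auto
  let ?d = "of_nat (card BV) / of_nat (card ?K) :: complex"
  \<comment> \<open>The action of \<open>P_r_pi\<close> on W: take the degree r part, then apply the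
    character sum over the centraliser.\<close>
  define proj where "proj w = (\<Sum>n\<in>?K. sW (P_pi G r sV BV \<pi> n) (act n (part r w)))" for w
  have proj: "proj w = sW ?d (\<Sum>n\<in>?K. sW (trace_in sV BV (\<pi> (inv\<^bsub>?GK\<^esub> n))) (act n (part r w)))" for w
    by (simp add: proj_def P_pi_def invK W.scale_sum_right V.dim_UNIV)
  have "proj w \<in> U" for w
  proof -
    \<comment> \<open>Up to the scalar \<open>?d\<close>, \<open>proj w\<close> is the sum of the
      values of these intertwiners at the basis vectors, so it is enough that each of them maps into
      U.\<close>
    let ?A = "\<lambda>b. rank_one_average ?GK sW \<pi> act (\<lambda>v. V.representation BV v b) (part r w)"
    have "range (?A b) \<subseteq> U" for b
    proof (rule range_subset_unique_copy[OF r irr unique _ _ U])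
      show "right_comodule (Hquot G r) sV UNIV (V_coaction G r \<pi>)"
        using iso by (simp add: right_comodules_isomorphic_def)
      show "right_comodule (Hquot G r) sW UNIV ?\<sigma>"
        using sub by (simp add: right_subcomodule_def)
      show "Vector_Spaces.linear sV sW (?A b)"
        by (rule linear_rank_one_average[OF groupK \<pi> act_rep V.vector_space_axioms
              W.vector_space_axioms linear_coordinate]) fact
      show "?A b (\<pi> k v) = act k (?A b v)" if "k \<in> ?K" for k v
        by (rule rank_one_average_equivariant[OF groupK \<pi> act_rep]) (simp add: that)
      \<comment> \<open>The centraliser preserves degree r, so averaging a degree r vector stays in
        that degree.\<close>
      have "part r (act n (part r w)) = act n (part r w)" if n: "n \<in> ?K" for n
      proof -
        have "n \<in> carrier G" "n \<otimes>\<^bsub>G\<^esub> r \<otimes>\<^bsub>G\<^esub> inv\<^bsub>G\<^esub> n = r" using n r by (simp_all add: mem_centraliser_iff)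
        then show ?thesis using r by (metis act_part part_part)
      qed
      then show "part r (?A b v) = ?A b v" for v
        by (simp add: rank_one_average_def part.sum part.scale)
    qed
    then have "(\<Sum>b\<in>BV. ?A b b) \<in> U" by (intro W.subspace_sum[OF U]) blast
    then show ?thesis
      using sum_character_scale[OF W.vector_space_axioms V.finite_Basis, where K = ?GK and s = sV
          and \<pi> = \<pi> and \<sigma> = act and w = "part r w"]
      by (simp add: proj W.subspace_scale[OF U])
  qed
  \<comment> \<open>Along \<open>\<iota>\<close> the operator becomes the character projection on V,
    which is the identity.\<close>
  moreover have "proj w = w" if w: "w \<in> U" for w
  proof -
    obtain v where v: "w = \<iota> v" using w \<iota>(2) by auto
    have "proj w = \<iota> (sV ?d (\<Sum>n\<in>?K. sV (trace_in sV BV (\<pi> (inv\<^bsub>?GK\<^esub> n))) (\<pi> n v)))"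
      by (simp add: proj v \<iota>(3,4) \<iota>.scale \<iota>.sum)
    also have "\<dots> = w"
      using character_projection_irreducible[OF groupK _ V.finite_dimensional_vector_space_axioms irr, of v]
        finK v by simp
    finally show ?thesis .
  qed
  \<comment> \<open>Values of \<open>proj\<close> lie in U and \<open>proj\<close> is the identity
    on U, so U is exactly its fixed space.\<close>
  ultimately have U_iff: "w \<in> U \<longleftrightarrow> proj w = w" for w by metis
  have "act k w \<in> U" if "k \<in> ?K" "w \<in> U" for k w
    using that \<iota>(2,4) by (metis rangeE rangeI)
  then have F: "F_ker_space G C q (P_r_pi G r sV BV \<pi>) sW \<rho> = conj_sections r U"
    unfolding P_r_pi_def
    by (intro F_ker_space_eq_conj_sections[OF r C]) (use assms(5,6) U_iff in \<open>auto simp: P_pi_def proj_def\<close>)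
  have E_sub: "left_subcomodule (Dvee G) (fscale sV) (tensor_space (carrier G \<times> carrier G))
      (coproduct_coaction (Dvee G) sV) (E_space G r sV \<pi>)"
    by (rule left_subcomodule_E_space[OF r V.vector_space_axioms \<pi>])
  have F_sub: "left_subcomodule (Dvee G) (fscale sW) (tensor_space (carrier G)) (Delta_L G \<rho>)
      (conj_sections r U)"
    by (rule left_subcomodule_conj_sections[OF r U])
  have "\<exists>\<phi>. intertwining_iso (fscale sV) (E_space G r sV \<pi>) (coproduct_coaction (Dvee G) sV)
      (fscale sW) (conj_sections r U) (Delta_L G \<rho>) \<phi>"
    using ex_intertwining_iso_conj_sections[OF r \<pi> \<iota>_lin \<iota>(1,4)] unfolding \<iota>(2) by blast
  then show ?thesis
    unfolding F left_comodules_isomorphic_def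
    using E_sub F_sub left_comodule_if_left_subcomodule[OF E_sub] left_comodule_if_left_subcomodule[OF F_sub]
    by blast
qed

end
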